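(* Let $M^m$ be a PNMC biharmonic submanifold in $\mathbb{S}^n$ with at most two distinct principal curvatures in the direction of the mean curvature vector field $H$. Then $M$ is PMC, i.e. $\nabla^\perp H=0$.
   Context: All manifolds are smooth and connected. $\mathbb{S}^n\subset\mathbb{R}^{n+1}$ is the unit Euclidean sphere. Let $\varphi:M^m\to N$ be the inclusion of an $m$-dimensional submanifold in a Riemannian manifold $N$, with mean curvature vector field $H$ (so $mH$ is the trace of the second fundamental form) and mean curvature $f=|H|$. $M$ is biharmonic if $\Delta H+\operatorname{trace}R^N(d\varphi(\cdot),H)d\varphi(\cdot)=0$, where $\Delta V=-\operatorname{trace}\nabla^2V$ is the rough Laplacian on sections of $\varphi^{-1}(TN)$ and $R^N(X,Y)=[\nabla_X,\nabla_Y]-\nabla_{[X,Y]}$. $M$ is PNMC if $f>0$ everywhere and $\nabla^\perp(H/f)=0$, where $\nabla^\perp$ is the normal connection; $M$ is PMC if $\nabla^\perp H=0$. "At most two distinct principal curvatures in the direction of $H$" means that at each point the Weingarten operator $A_H$ has at most two distinct eigenvalues. *)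

theory Defs
  imports "HOL-Analysis.Analysis"
begin

(* The ambient Euclidean space is a type 'a of class euclidean_space, and the unit sphere S^n is
   sphere (0::'a) 1 with n + 1 = DIM('a).  The dimension of the submanifold is m = CARD('m). *)

section \<open>Smooth maps\<close>

primrec C_on :: "nat \<Rightarrow> 'b::real_normed_vector set \<Rightarrow> ('b \<Rightarrow> 'a::real_normed_vector) \<Rightarrow> bool" where
  "C_on 0 U f \<longleftrightarrow> continuous_on U f"
| "C_on (Suc k) U f \<longleftrightarrow> (\<forall>u\<in>U. f differentiable (at u)) \<and>
     (\<forall>h. C_on k U (\<lambda>u. frechet_derivative f (at u) h))"

definition smooth_on :: "'b::real_normed_vector set \<Rightarrow> ('b \<Rightarrow> 'a::real_normed_vector) \<Rightarrow> bool" where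
  "smooth_on U f \<longleftrightarrow> (\<forall>k. C_on k U f)"

section \<open>Submanifolds of the unit sphere\<close>

(* A (possibly only immersed) submanifold is a subset of the sphere with its own topology, given
   together as M :: 'a topology; an embedded submanifold S is the case M = top_of_set S.
   No atlas has to be recorded: a manifold topology on a subset of 'a carries at most one smooth
   structure making the inclusion an immersion, and its charts are the inverses of the
   parametrizations below, whose transition maps are automatically smooth. *)

definition local_parametrization ::
    "'a::euclidean_space topology \<Rightarrow> (real^'m::finite) set \<Rightarrow> (real^'m \<Rightarrow> 'a) \<Rightarrow> bool" where
  "local_parametrization M U x \<longleftrightarrow>
     open U \<and> smooth_on U x \<and> (\<forall>u\<in>U. inj (frechet_derivative x (at u))) \<and>
     openin M (x ` U) \<and> homeomorphic_map (top_of_set U) (subtopology M (x ` U)) x"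

definition submanifold_of_sphere :: "'m::finite itself \<Rightarrow> 'a::euclidean_space topology \<Rightarrow> bool" where
  "submanifold_of_sphere TYPE('m) M \<longleftrightarrow>
     topspace M \<subseteq> sphere 0 1 \<and> Hausdorff_space M \<and> second_countable M \<and> connected_space M \<and>
     (\<forall>p\<in>topspace M. \<exists>U (x :: real^'m \<Rightarrow> 'a). local_parametrization M U x \<and> p \<in> x ` U)"

section \<open>Levi-Civita connection and curvature of the unit sphere\<close>

(* For p on the sphere this is the orthogonal projection onto the tangent space of the sphere at p. *)
definition sphere_proj :: "'a::euclidean_space \<Rightarrow> 'a \<Rightarrow> 'a" where
  "sphere_proj p w = w - (w \<bullet> p) *\<^sub>R p"

(* Vector fields on the sphere are represented by extensions to 'a.  At points of the sphere, and
   for X tangent to it, the following depend only on the restrictions to the sphere. *)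
definition sphere_connection :: "('a \<Rightarrow> 'a) \<Rightarrow> ('a \<Rightarrow> 'a) \<Rightarrow> 'a::euclidean_space \<Rightarrow> 'a" where
  "sphere_connection X Y = (\<lambda>q. sphere_proj q (frechet_derivative Y (at q) (X q)))"

definition lie_bracket :: "('a \<Rightarrow> 'a) \<Rightarrow> ('a \<Rightarrow> 'a) \<Rightarrow> 'a::euclidean_space \<Rightarrow> 'a" where
  "lie_bracket X Y = (\<lambda>q. frechet_derivative Y (at q) (X q) - frechet_derivative X (at q) (Y q))"

definition sphere_curvature_fields ::
    "('a \<Rightarrow> 'a) \<Rightarrow> ('a \<Rightarrow> 'a) \<Rightarrow> ('a \<Rightarrow> 'a) \<Rightarrow> 'a::euclidean_space \<Rightarrow> 'a" where
  "sphere_curvature_fields X Y Z = (\<lambda>q.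
     sphere_connection X (sphere_connection Y Z) q - sphere_connection Y (sphere_connection X Z) q
     - sphere_connection (lie_bracket X Y) Z q)"

(* The curvature tensor R(u,v)w at a point p of the sphere, for tangent vectors u, v, w at p.
   By tensoriality any tangent extensions of u, v, w may be used; these are tangent to the
   sphere and take the values u, v, w at p. *)
definition sphere_curvature :: "'a \<Rightarrow> 'a \<Rightarrow> 'a \<Rightarrow> 'a \<Rightarrow> 'a::euclidean_space" where
  "sphere_curvature p u v w =
     sphere_curvature_fields (\<lambda>q. sphere_proj q u) (\<lambda>q. sphere_proj q v) (\<lambda>q. sphere_proj q w) p"

lemma fd_proj: "frechet_derivative (\<lambda>q. sphere_proj q w) (at q) = (\<lambda>h. - (w \<bullet> h) *\<^sub>R q - (w \<bullet> q) *\<^sub>R h)"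
  for w q :: "'a::euclidean_space"
  unfolding sphere_proj_def
  by (rule frechet_derivative_at[symmetric]) (auto intro!: derivative_eq_intros)

lemma conn_proj: "sphere_connection (\<lambda>q. sphere_proj q v) (\<lambda>q. sphere_proj q w) = (\<lambda>q::'a::euclidean_space.
   - ((w \<bullet> v - (v \<bullet> q) * (w \<bullet> q))) *\<^sub>R (q - (q \<bullet> q) *\<^sub>R q) - (w \<bullet> q) *\<^sub>R sphere_proj q (sphere_proj q v))"
  unfolding sphere_connection_def fd_proj
  by (rule ext, simp add: sphere_proj_def algebra_simps inner_simps)
     (simp flip: scaleR_add_left)

lemma fd_conn: 
  fixes p u v w :: "'a::euclidean_space" assumes p: "p \<bullet> p = 1" "v \<bullet> p = 0" "w \<bullet> p = 0" "h \<bullet> p = 0"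
  shows "sphere_proj p (frechet_derivative (sphere_connection (\<lambda>q. sphere_proj q v) (\<lambda>q. sphere_proj q w)) (at p) h)
    = - (w \<bullet> h) *\<^sub>R v"
proof -
  have "((\<lambda>q::'a. - ((w \<bullet> v - (v \<bullet> q) * (w \<bullet> q))) *\<^sub>R (q - (q \<bullet> q) *\<^sub>R q) - (w \<bullet> q) *\<^sub>R sphere_proj q (sphere_proj q v))
    has_derivative (\<lambda>h. - (w \<bullet> v) *\<^sub>R (- (2 * (p \<bullet> h)) *\<^sub>R p) - (w \<bullet> h) *\<^sub>R v)) (at p)"
    unfolding sphere_proj_def
    apply (rule derivative_eq_intros refl ext | (rule has_derivative_eq_rhs))+
    using p by (simp add: algebra_simps inner_simps inner_commute flip: scaleR_2)
  note fd = frechet_derivative_at[OF this, symmetric]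
  show ?thesis unfolding conn_proj fd using p by (simp add: sphere_proj_def algebra_simps inner_simps inner_commute)
qed

lemma sphere_curvature_eq:
  fixes p :: "'a::euclidean_space"
  assumes p: "p \<in> sphere 0 1" "u \<bullet> p = 0" "v \<bullet> p = 0" "w \<bullet> p = 0"
  shows "sphere_curvature p u v w = (v \<bullet> w) *\<^sub>R u - (u \<bullet> w) *\<^sub>R v"
proof -
  have pp: "p \<bullet> p = 1" using p by (simp add: dot_square_norm)
  have pr: "sphere_proj p u = u" "sphere_proj p v = v" using p by (auto simp: sphere_proj_def inner_commute)
  have l: "lie_bracket (\<lambda>q. sphere_proj q u) (\<lambda>q. sphere_proj q v) p = 0"
    using p unfolding lie_bracket_def fd_proj by (simp add: pr inner_commute)
  have 3: "sphere_connection (lie_bracket (\<lambda>q. sphere_proj q u) (\<lambda>q. sphere_proj q v)) (\<lambda>q. sphere_proj q w) p = 0"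
    unfolding sphere_connection_def l fd_proj by (simp add: sphere_proj_def)
  have 1: "sphere_connection (\<lambda>q. sphere_proj q a) Y p = sphere_proj p (frechet_derivative Y (at p) a)" 
    if "a \<bullet> p = 0" for a Y using that by (simp add: sphere_connection_def sphere_proj_def)
  show ?thesis unfolding sphere_curvature_def sphere_curvature_fields_def 3
    using p pp by (simp add: 1 fd_conn inner_commute)
qed

section \<open>Geometry of a parametrized submanifold of the sphere\<close>

(* Throughout, x is a local parametrization and a vector field V along M (a section of the
   pullback of the tangent bundle of the sphere) is represented by the function u \<mapsto> V (x u). *)

definition pderiv_at :: "'m \<Rightarrow> (real^'m::finite \<Rightarrow> 'b::real_normed_vector) \<Rightarrow> real^'m \<Rightarrow> 'b" where
  "pderiv_at i V u = frechet_derivative V (at u) (axis i 1)"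

definition induced_metric :: "(real^'m::finite \<Rightarrow> 'a::euclidean_space) \<Rightarrow> real^'m \<Rightarrow> real^'m^'m" where
  "induced_metric x u = (\<chi> i j. pderiv_at i x u \<bullet> pderiv_at j x u)"

definition metric_inv :: "(real^'m::finite \<Rightarrow> 'a::euclidean_space) \<Rightarrow> real^'m \<Rightarrow> real^'m^'m" where
  "metric_inv x u = matrix_inv (induced_metric x u)"

definition metric_trace ::
    "(real^'m::finite \<Rightarrow> 'a::euclidean_space) \<Rightarrow> real^'m \<Rightarrow> ('m \<Rightarrow> 'm \<Rightarrow> 'b::real_vector) \<Rightarrow> 'b" where
  "metric_trace x u T = (\<Sum>i\<in>UNIV. \<Sum>j\<in>UNIV. metric_inv x u $ i $ j *\<^sub>R T i j)"

(* christoffel x k i j is Gamma^k_ij of the Levi-Civita connection of the induced metric. *)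
definition christoffel ::
    "(real^'m::finite \<Rightarrow> 'a::euclidean_space) \<Rightarrow> 'm \<Rightarrow> 'm \<Rightarrow> 'm \<Rightarrow> real^'m \<Rightarrow> real" where
  "christoffel x k i j u = (\<Sum>l\<in>UNIV. metric_inv x u $ k $ l *
     (pderiv_at i (\<lambda>v. induced_metric x v $ j $ l) u + pderiv_at j (\<lambda>v. induced_metric x v $ i $ l) u
      - pderiv_at l (\<lambda>v. induced_metric x v $ i $ j) u)) / 2"

(* The orthogonal projection of 'a onto the tangent space of M at x u, the range of dx_u. *)
definition tangent_part ::
    "(real^'m::finite \<Rightarrow> 'a::euclidean_space) \<Rightarrow> real^'m \<Rightarrow> 'a \<Rightarrow> 'a" where
  "tangent_part x u w = metric_trace x u (\<lambda>i j. (w \<bullet> pderiv_at i x u) *\<^sub>R pderiv_at j x u)"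

lemma tangent_part_orthogonal_projection:
  fixes x :: "real^'m::finite \<Rightarrow> 'a::euclidean_space"
  assumes x: "x differentiable (at u)" "inj (frechet_derivative x (at u))"
  shows "tangent_part x u w \<in> range (frechet_derivative x (at u))"
    and "t \<in> range (frechet_derivative x (at u)) \<Longrightarrow> (w - tangent_part x u w) \<bullet> t = 0"
proof -
  define D where "D = frechet_derivative x (at u)"
  have lin: "linear D" unfolding D_def using linear_frechet_derivative[OF x(1)] .
  have expand: "D h = (\<Sum>j\<in>UNIV. h $ j *\<^sub>R D (axis j 1))" for h
  proof -
    have "h = (\<Sum>j\<in>UNIV. h $ j *\<^sub>R axis j 1)"
      using basis_expansion[of h] by (simp add: scalar_mult_eq_scaleR)
    then have "D h = D (\<Sum>j\<in>UNIV. h $ j *\<^sub>R axis j 1)" by simp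
    also have "\<dots> = (\<Sum>j\<in>UNIV. h $ j *\<^sub>R D (axis j 1))"
      by (simp add: linear_sum[OF lin] linear_scale[OF lin])
    finally show ?thesis .
  qed
  let ?g = "induced_metric x u"
  have gij: "?g $ i $ j = D (axis i 1) \<bullet> D (axis j 1)" for i j
    by (simp add: induced_metric_def pderiv_at_def D_def)
  have "h = 0" if "?g *v h = 0" for h
  proof -
    have "(\<Sum>i\<in>UNIV. h $ i * (?g *v h) $ i) = D h \<bullet> D h"
      by (simp add: matrix_vector_mult_def gij expand[of h] inner_sum_left inner_sum_right sum_distrib_left algebra_simps inner_commute)
    then have "D h = 0" using that by simp
    moreover have "D 0 = 0" using linear_0[OF lin] .
    ultimately show "h = 0" using x(2) unfolding D_def[symmetric] by (metis injD)
  qed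
  then have "invertible ?g"
    by (simp add: invertible_left_inverse matrix_left_invertible_ker)
  then have inv: "metric_inv x u ** ?g = mat 1"
    unfolding metric_inv_def matrix_inv_def invertible_def by (rule someI2_ex) auto
  have tp: "tangent_part x u w = D (\<chi> j. \<Sum>i\<in>UNIV. metric_inv x u $ i $ j * (w \<bullet> D (axis i 1)))"
    unfolding expand[of "\<chi> j. _ j"] tangent_part_def metric_trace_def pderiv_at_def D_def[symmetric]
    by (subst sum.swap) (simp add: scaleR_sum_left)
  show "tangent_part x u w \<in> range (frechet_derivative x (at u))"
    unfolding tp D_def[symmetric] by simp
  have "tangent_part x u w \<bullet> D (axis k 1) = w \<bullet> D (axis k 1)" for k
  proof -
    have "tangent_part x u w \<bullet> D (axis k 1)
      = (\<Sum>i\<in>UNIV. (w \<bullet> D (axis i 1)) * (metric_inv x u ** ?g) $ i $ k)"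
      by (simp add: tangent_part_def metric_trace_def pderiv_at_def D_def[symmetric] matrix_matrix_mult_def
        gij inner_sum_left sum_distrib_left algebra_simps)
    also have "\<dots> = w \<bullet> D (axis k 1)" unfolding inv mat_def by (simp add: if_distrib cong: if_cong)
    finally show ?thesis .
  qed
  then have "(w - tangent_part x u w) \<bullet> D h = 0" for h
    by (simp add: expand[of h] inner_sum_right inner_diff_left)
  then show "t \<in> range (frechet_derivative x (at u)) \<Longrightarrow> (w - tangent_part x u w) \<bullet> t = 0"
    unfolding D_def[symmetric] by auto
qed

(* For w tangent to the sphere: the component in the normal space of M in the sphere. *)
definition normal_part ::
    "(real^'m::finite \<Rightarrow> 'a::euclidean_space) \<Rightarrow> real^'m \<Rightarrow> 'a \<Rightarrow> 'a" where
  "normal_part x u w = w - tangent_part x u w"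

(* The pullback connection: covariant derivative of V along dx_u(h). *)
definition pullback_connection ::
    "(real^'m::finite \<Rightarrow> 'a::euclidean_space) \<Rightarrow> real^'m \<Rightarrow> (real^'m \<Rightarrow> 'a) \<Rightarrow> real^'m \<Rightarrow> 'a" where
  "pullback_connection x h V u = sphere_proj (x u) (frechet_derivative V (at u) h)"

definition normal_connection ::
    "(real^'m::finite \<Rightarrow> 'a::euclidean_space) \<Rightarrow> real^'m \<Rightarrow> (real^'m \<Rightarrow> 'a) \<Rightarrow> real^'m \<Rightarrow> 'a" where
  "normal_connection x h V u = normal_part x u (pullback_connection x h V u)"

definition second_fundamental_form ::
    "(real^'m::finite \<Rightarrow> 'a::euclidean_space) \<Rightarrow> 'm \<Rightarrow> 'm \<Rightarrow> real^'m \<Rightarrow> 'a" where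
  "second_fundamental_form x i j u =
     normal_part x u (pullback_connection x (axis i 1) (pderiv_at j x) u)"

definition mean_curvature_vector ::
    "(real^'m::finite \<Rightarrow> 'a::euclidean_space) \<Rightarrow> real^'m \<Rightarrow> 'a" where
  "mean_curvature_vector x u =
     (1 / real CARD('m)) *\<^sub>R metric_trace x u (\<lambda>i j. second_fundamental_form x i j u)"

definition mean_curvature :: "(real^'m::finite \<Rightarrow> 'a::euclidean_space) \<Rightarrow> real^'m \<Rightarrow> real" where
  "mean_curvature x u = norm (mean_curvature_vector x u)"

(* The Weingarten operator A_V applied to the tangent vector dx_u(h), for a normal field V. *)
definition weingarten ::
    "(real^'m::finite \<Rightarrow> 'a::euclidean_space) \<Rightarrow> (real^'m \<Rightarrow> 'a) \<Rightarrow> real^'m \<Rightarrow> real^'m \<Rightarrow> 'a" where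
  "weingarten x V u h = - tangent_part x u (pullback_connection x h V u)"

definition weingarten_eigenvalues ::
    "(real^'m::finite \<Rightarrow> 'a::euclidean_space) \<Rightarrow> (real^'m \<Rightarrow> 'a) \<Rightarrow> real^'m \<Rightarrow> real set" where
  "weingarten_eigenvalues x V u =
     {c. \<exists>h. h \<noteq> 0 \<and> weingarten x V u h = c *\<^sub>R frechet_derivative x (at u) h}"

definition hessian ::
    "(real^'m::finite \<Rightarrow> 'a::euclidean_space) \<Rightarrow> (real^'m \<Rightarrow> 'a) \<Rightarrow> 'm \<Rightarrow> 'm \<Rightarrow> real^'m \<Rightarrow> 'a" where
  "hessian x V i j u =
     pullback_connection x (axis i 1) (pullback_connection x (axis j 1) V) u
     - (\<Sum>k\<in>UNIV. christoffel x k i j u *\<^sub>R pullback_connection x (axis k 1) V u)"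

definition rough_laplacian ::
    "(real^'m::finite \<Rightarrow> 'a::euclidean_space) \<Rightarrow> (real^'m \<Rightarrow> 'a) \<Rightarrow> real^'m \<Rightarrow> 'a" where
  "rough_laplacian x V u = - metric_trace x u (\<lambda>i j. hessian x V i j u)"

section \<open>Classes of submanifolds\<close>

(* The quantities below do not depend on the parametrization, so the conditions are imposed in
   every local parametrization. *)

definition biharmonic :: "'m::finite itself \<Rightarrow> 'a::euclidean_space topology \<Rightarrow> bool" where
  "biharmonic TYPE('m) M \<longleftrightarrow>
     (\<forall>U (x :: real^'m \<Rightarrow> 'a). local_parametrization M U x \<longrightarrow> (\<forall>u\<in>U.
        rough_laplacian x (mean_curvature_vector x) u
        + metric_trace x u (\<lambda>i j. sphere_curvature (x u)
            (pderiv_at i x u) (mean_curvature_vector x u) (pderiv_at j x u)) = 0))"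

definition PNMC :: "'m::finite itself \<Rightarrow> 'a::euclidean_space topology \<Rightarrow> bool" where
  "PNMC TYPE('m) M \<longleftrightarrow>
     (\<forall>U (x :: real^'m \<Rightarrow> 'a). local_parametrization M U x \<longrightarrow> (\<forall>u\<in>U.
        mean_curvature x u > 0 \<and>
        (\<forall>h. normal_connection x h (\<lambda>v. mean_curvature_vector x v /\<^sub>R mean_curvature x v) u = 0)))"

definition PMC :: "'m::finite itself \<Rightarrow> 'a::euclidean_space topology \<Rightarrow> bool" where
  "PMC TYPE('m) M \<longleftrightarrow>
     (\<forall>U (x :: real^'m \<Rightarrow> 'a). local_parametrization M U x \<longrightarrow> (\<forall>u\<in>U.
        \<forall>h. normal_connection x h (mean_curvature_vector x) u = 0))"

definition at_most_two_principal_curvatures_along_H ::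
    "'m::finite itself \<Rightarrow> 'a::euclidean_space topology \<Rightarrow> bool" where
  "at_most_two_principal_curvatures_along_H TYPE('m) M \<longleftrightarrow>
     (\<forall>U (x :: real^'m \<Rightarrow> 'a). local_parametrization M U x \<longrightarrow> (\<forall>u\<in>U.
        finite (weingarten_eigenvalues x (mean_curvature_vector x) u) \<and>
        card (weingarten_eigenvalues x (mean_curvature_vector x) u) \<le> 2))"

end

theory Submission
  imports Defs
begin

text \<open>
  Write \<open>H = f \<xi>\<close> with \<open>\<xi>\<close> a parallel unit normal field, and let \<open>A\<close> be the Weingarten operator of \<open>\<xi>\<close>.
  Since the trace of \<open>A\<close> is \<open>m f\<close>, the Codazzi equation turns the tangential part of the
  biharmonic equation into \<open>A (grad f) = \<nu> grad f\<close> with \<open>\<nu> = - m f / 2\<close>.  Suppose that \<open>grad f\<close> does not vanish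
  on an open set.  An eigenvalue of a Codazzi tensor of multiplicity at least two is constant along its
  eigenspaces, so \<open>\<nu>\<close> is simple, and the trace gives the other eigenvalue \<open>\<mu> = c f\<close> with
  \<open>c = 3 m / (2 (m - 1))\<close>.  Hence \<open>F = \<xi> + \<mu> x\<close> has \<open>dF = G df\<close>, that is, \<open>F\<close> is locally a curve
  parametrized by \<open>f\<close>, with \<open>F' = G = c x + \<psi> grad f\<close>.  The normal part of the biharmonic equation forces \<open>F''\<close>
  into the span of \<open>x\<close>, \<open>\<xi>\<close> and \<open>grad f\<close>.  Comparing components of \<open>\<Delta> F = \<Delta> f F' + |grad f|\<^sup>2 F''\<close> and of
  \<open>dF'' = F''' df\<close> (which contains the Gauss equation) gives
  \<open>c (2 c - m) |grad f|\<^sup>2 = polynomial in f\<close>, and differentiating once more along \<open>grad f\<close> yields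
  an equation \<open>K0 + K1 f\<^sup>2 = 0\<close> with positive constants, a contradiction.
\<close>

section \<open>Calculus of smooth maps\<close>

text \<open>All fields are maps into the ambient Euclidean space, differentiated componentwise;
  geometry enters through inner products with \<open>x\<close>, \<xi> and the coordinate frame.
  Codazzi and Gauss type identities thereby become the symmetry of second partial derivatives, and
  Christoffel symbols survive only as tangential coordinates of second derivatives of
  \<open>x\<close>. The codimension is arbitrary, so nothing is known about the second fundamental
  form in normal directions orthogonal to \<xi>. The map \<open>F\<close> is made to get around
  this: \<xi> + \<mu> \<open>x\<close> is, up to scaling, the focal point of \<open>x\<close> in the
  direction \<xi> belonging to the curvature \<mu>. It does not move along the level sets of
  \<open>f\<close>, and the part of its second derivative in \<open>f\<close> that is orthogonal to
  \<open>x\<close>, \<xi> and the gradient is exactly what the normal biharmonic equation kills. Two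
  more obstacles shape the proof. The second eigenvalue must be smooth before its multiplicity is
  known, so it is defined by traces. And 2 c - m = m (4 - m) / (m - 1) vanishes for m = 4, so the
  final equations are never divided by it.\<close>

lemma C_on_cong:
  assumes "open U" and "\<And>u. u \<in> U \<Longrightarrow> f u = g u" and "C_on k U f"
  shows "C_on k U g"
  using assms(2,3)
proof (induction k arbitrary: f g)
  case 0
  then show ?case by (simp cong: continuous_on_cong)
next
  case (Suc k)
  have eq: "(g has_derivative frechet_derivative f (at u)) (at u)" if "u \<in> U" for u
  proof (rule has_derivative_transform_within_open[OF _ assms(1) that])
    show "(f has_derivative frechet_derivative f (at u)) (at u)"
      using Suc.prems(2) that by (simp flip: frechet_derivative_works)
  qed (rule Suc.prems)
  have "frechet_derivative f (at u) = frechet_derivative g (at u)" if "u \<in> U" for u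
    using frechet_derivative_at[OF eq[OF that]] .
  then have "C_on k U (\<lambda>u. frechet_derivative g (at u) h)" for h
    using Suc.prems by - (rule Suc.IH[where f="\<lambda>u. frechet_derivative f (at u) h"], auto)
  moreover have "g differentiable (at u)" if "u \<in> U" for u
    using eq[OF that] by (rule differentiableI)
  ultimately show ?case by simp
qed

lemma C_on_Suc_imp:
  assumes "C_on (Suc k) U f" shows "C_on k U f"
  using assms
proof (induction k arbitrary: f)
  case 0
  then show ?case
    by (auto intro!: continuous_at_imp_continuous_on differentiable_imp_continuous_within)
next
  case (Suc k)
  have "C_on k U (\<lambda>u. frechet_derivative f (at u) h)" for h
    using Suc.prems by (intro Suc.IH) simp
  with Suc.prems show ?case by simp
qed

lemma C_on_bounded_linear:
  assumes "open U" "bounded_linear L" "C_on k U f"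
  shows "C_on k U (\<lambda>u. L (f u))"
  using assms(3)
proof (induction k arbitrary: f)
  case 0
  then show ?case by (simp add: bounded_linear.continuous_on[OF assms(2)])
next
  case (Suc k)
  have d: "((\<lambda>u. L (f u)) has_derivative (\<lambda>h. L (frechet_derivative f (at u) h))) (at u)" if "u \<in> U" for u
    using Suc.prems that by (intro bounded_linear.has_derivative[OF assms(2)]) (auto simp: frechet_derivative_works)
  have *: "C_on k U (\<lambda>u. L (frechet_derivative f (at u) h))" for h
    using Suc by simp
  have "C_on k U (\<lambda>u. frechet_derivative (\<lambda>u. L (f u)) (at u) h)" for h
    by (rule C_on_cong[OF assms(1) _ *[of h]]) (simp add: frechet_derivative_at[OF d, symmetric])
  then show ?case using d by (auto intro: differentiableI)
qed

lemma C_on_add: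
  assumes "open U" "C_on k U f" "C_on k U g"
  shows "C_on k U (\<lambda>u. f u + g u)"
  using assms(2,3)
proof (induction k arbitrary: f g)
  case 0
  then show ?case by (auto intro: continuous_intros)
next
  case (Suc k)
  have d: "((\<lambda>u. f u + g u) has_derivative (\<lambda>h. frechet_derivative f (at u) h + frechet_derivative g (at u) h)) (at u)"
    if "u \<in> U" for u
    using Suc.prems that by (intro has_derivative_add) (auto simp: frechet_derivative_works)
  have *: "C_on k U (\<lambda>u. frechet_derivative f (at u) h + frechet_derivative g (at u) h)" for h
    using Suc by simp
  have "C_on k U (\<lambda>u. frechet_derivative (\<lambda>u. f u + g u) (at u) h)" for h
    by (rule C_on_cong[OF assms(1) _ *[of h]]) (simp add: frechet_derivative_at[OF d, symmetric])
  then show ?case using d by (auto intro: differentiableI)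
qed

lemma C_on_bounded_bilinear:
  assumes "open U" "bounded_bilinear B" "C_on k U f" "C_on k U g"
  shows "C_on k U (\<lambda>u. B (f u) (g u))"
  using assms(3,4)
proof (induction k arbitrary: f g)
  case 0
  then show ?case by (simp add: bounded_bilinear.continuous_on[OF assms(2)])
next
  case (Suc k)
  have d: "((\<lambda>u. B (f u) (g u)) has_derivative
      (\<lambda>h. B (f u) (frechet_derivative g (at u) h) + B (frechet_derivative f (at u) h) (g u))) (at u)"
    if "u \<in> U" for u
    using Suc.prems that
    by (intro bounded_bilinear.FDERIV[OF assms(2)]) (auto simp: frechet_derivative_works)
  have *: "C_on k U (\<lambda>u. B (f u) (frechet_derivative g (at u) h) + B (frechet_derivative f (at u) h) (g u))" for h
    using Suc.prems C_on_Suc_imp[OF Suc.prems(1)] C_on_Suc_imp[OF Suc.prems(2)]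
    by (intro C_on_add[OF assms(1)] Suc.IH) auto
  have "C_on k U (\<lambda>u. frechet_derivative (\<lambda>u. B (f u) (g u)) (at u) h)" for h
    by (rule C_on_cong[OF assms(1) _ *[of h]]) (simp add: frechet_derivative_at[OF d, symmetric])
  then show ?case using d by (auto intro: differentiableI)
qed

lemma C_on_const: "C_on k U (\<lambda>u. c)"
  by (induction k arbitrary: c) auto

text \<open>The derivative is a product of \<open>inverse (f u)\<close>, twice, with a derivative of
  \<open>f\<close>, so the induction hypothesis applies to the very function that is being
  differentiated.\<close>

lemma C_on_inverse:
  fixes f :: "'b::real_normed_vector \<Rightarrow> real"
  assumes "open U" "\<And>u. u \<in> U \<Longrightarrow> f u \<noteq> 0" "C_on k U f"
  shows "C_on k U (\<lambda>u. inverse (f u))"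
  using assms(3)
proof (induction k)
  case 0
  then show ?case using assms(2) by (auto intro!: continuous_intros)
next
  case (Suc k)
  have d: "((\<lambda>u. inverse (f u)) has_derivative
      (\<lambda>h. - (inverse (f u) * frechet_derivative f (at u) h * inverse (f u)))) (at u)" if "u \<in> U" for u
    using Suc.prems that assms(2)
    by (intro Deriv.has_derivative_inverse) (auto simp: frechet_derivative_works)
  have *: "C_on k U (\<lambda>u. - (inverse (f u) * frechet_derivative f (at u) h * inverse (f u)))" for h
    using Suc.prems Suc.IH C_on_Suc_imp[OF Suc.prems]
    by (intro C_on_bounded_linear[OF assms(1) bounded_linear_minus[OF bounded_linear_ident]]
        C_on_bounded_bilinear[OF assms(1) bounded_bilinear_mult]) auto
  have "C_on k U (\<lambda>u. frechet_derivative (\<lambda>u. inverse (f u)) (at u) h)" for h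
    by (rule C_on_cong[OF assms(1) _ *[of h]]) (simp add: frechet_derivative_at[OF d, symmetric])
  then show ?case using d by (auto intro: differentiableI)
qed

lemma C_on_sqrt:
  fixes f :: "'b::real_normed_vector \<Rightarrow> real"
  assumes "open U" "\<And>u. u \<in> U \<Longrightarrow> f u > 0" "C_on k U f"
  shows "C_on k U (\<lambda>u. sqrt (f u))"
  using assms(3)
proof (induction k)
  case 0
  then show ?case using assms(2) by (auto intro!: continuous_intros)
next
  case (Suc k)
  have d: "((\<lambda>u. sqrt (f u)) has_derivative
      (\<lambda>h. inverse (2 * sqrt (f u)) * frechet_derivative f (at u) h)) (at u)" if "u \<in> U" for u
    using Suc.prems that assms(2)[OF that]
    by (auto intro!: derivative_eq_intros simp: frechet_derivative_works field_simps)
  have *: "C_on k U (\<lambda>u. inverse (2 * sqrt (f u)) * frechet_derivative f (at u) h)" for h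
    using Suc.prems Suc.IH C_on_Suc_imp[OF Suc.prems] assms(2)
    by (intro C_on_bounded_bilinear[OF assms(1) bounded_bilinear_mult] C_on_inverse[OF assms(1)] C_on_const)
     (auto simp: less_imp_neq[symmetric] order.strict_implies_not_eq)
  have "C_on k U (\<lambda>u. frechet_derivative (\<lambda>u. sqrt (f u)) (at u) h)" for h
    by (rule C_on_cong[OF assms(1) _ *[of h]]) (simp add: frechet_derivative_at[OF d, symmetric])
  then show ?case using d by (auto intro: differentiableI)
qed

lemma smooth_on_differentiable: "smooth_on U f \<Longrightarrow> u \<in> U \<Longrightarrow> f differentiable (at u)"
  unfolding smooth_on_def by (metis C_on.simps(2))

lemma smooth_on_frechet_derivative: "smooth_on U f \<Longrightarrow> smooth_on U (\<lambda>u. frechet_derivative f (at u) h)"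
  unfolding smooth_on_def by (metis C_on.simps(2))

lemma smooth_on_pderiv_at: "smooth_on U f \<Longrightarrow> smooth_on U (pderiv_at i f)"
  using smooth_on_frechet_derivative unfolding pderiv_at_def[abs_def] .

lemma smooth_on_continuous: "smooth_on U f \<Longrightarrow> continuous_on U f"
  unfolding smooth_on_def by (metis C_on.simps(1))

lemma smooth_on_cong:
  assumes "open U" "smooth_on U f" "\<And>u. u \<in> U \<Longrightarrow> f u = g u"
  shows "smooth_on U g"
  using assms C_on_cong unfolding smooth_on_def by blast

lemma smooth_on_subset:
  assumes "smooth_on U f" "V \<subseteq> U"
  shows "smooth_on V f"
proof -
  have "C_on k V f" if "C_on k U f" for k and f :: "'a \<Rightarrow> 'b"
    using that
  proof (induction k arbitrary: f)
    case 0
    then show ?case using assms(2) continuous_on_subset by auto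
  next
    case (Suc k)
    then show ?case using assms(2) by auto
  qed
  then show ?thesis using assms(1) by (simp add: smooth_on_def)
qed

lemma smooth_on_const: "smooth_on U (\<lambda>u. c)"
  by (simp add: smooth_on_def C_on_const)

lemma smooth_on_add: "open U \<Longrightarrow> smooth_on U f \<Longrightarrow> smooth_on U g \<Longrightarrow> smooth_on U (\<lambda>u. f u + g u)"
  by (simp add: smooth_on_def C_on_add)

lemma smooth_on_scaleR: "open U \<Longrightarrow> smooth_on U f \<Longrightarrow> smooth_on U g \<Longrightarrow> smooth_on U (\<lambda>u. f u *\<^sub>R g u)"
  by (simp add: smooth_on_def C_on_bounded_bilinear[OF _ bounded_bilinear_scaleR])

lemma smooth_on_inner: "open U \<Longrightarrow> smooth_on U f \<Longrightarrow> smooth_on U g \<Longrightarrow> smooth_on U (\<lambda>u. f u \<bullet> g u)"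
  by (simp add: smooth_on_def C_on_bounded_bilinear[OF _ bounded_bilinear_inner])

lemma smooth_on_mult:
  fixes f g :: "'b::real_normed_vector \<Rightarrow> real"
  shows "open U \<Longrightarrow> smooth_on U f \<Longrightarrow> smooth_on U g \<Longrightarrow> smooth_on U (\<lambda>u. f u * g u)"
  by (simp add: smooth_on_def C_on_bounded_bilinear[OF _ bounded_bilinear_mult])

lemma smooth_on_minus: "open U \<Longrightarrow> smooth_on U f \<Longrightarrow> smooth_on U (\<lambda>u. - f u)"
  by (simp add: smooth_on_def C_on_bounded_linear[OF _ bounded_linear_minus[OF bounded_linear_ident]])

lemma smooth_on_diff: "open U \<Longrightarrow> smooth_on U f \<Longrightarrow> smooth_on U g \<Longrightarrow> smooth_on U (\<lambda>u. f u - g u)"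
  using smooth_on_add[OF _ _ smooth_on_minus, of U f g] by simp

lemma smooth_on_sum:
  assumes "open U" "\<And>i. i \<in> I \<Longrightarrow> smooth_on U (f i)"
  shows "smooth_on U (\<lambda>u. \<Sum>i\<in>I. f i u)"
  using assms(2) by (induction I rule: infinite_finite_induct) (auto intro: smooth_on_const smooth_on_add[OF assms(1)])

lemma smooth_on_prod:
  fixes f :: "'i \<Rightarrow> 'b::real_normed_vector \<Rightarrow> real"
  assumes "open U" "\<And>i. i \<in> I \<Longrightarrow> smooth_on U (f i)"
  shows "smooth_on U (\<lambda>u. \<Prod>i\<in>I. f i u)"
  using assms(2) by (induction I rule: infinite_finite_induct) (auto intro: smooth_on_const smooth_on_mult[OF assms(1)])

lemma smooth_on_divide:
  fixes f g :: "'b::real_normed_vector \<Rightarrow> real"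
  assumes "open U" "smooth_on U f" "smooth_on U g" "\<And>u. u \<in> U \<Longrightarrow> g u \<noteq> 0"
  shows "smooth_on U (\<lambda>u. f u / g u)"
  using smooth_on_mult[OF assms(1,2), of "\<lambda>u. inverse (g u)"] C_on_inverse[OF assms(1,4)] assms(3)
  by (simp add: smooth_on_def divide_inverse)

lemma smooth_on_sqrt:
  fixes f :: "'b::real_normed_vector \<Rightarrow> real"
  shows "open U \<Longrightarrow> smooth_on U f \<Longrightarrow> (\<And>u. u \<in> U \<Longrightarrow> f u > 0) \<Longrightarrow> smooth_on U (\<lambda>u. sqrt (f u))"
  by (simp add: smooth_on_def C_on_sqrt)

section \<open>Smooth dependence of the inverse matrix on its entries\<close>

lemma smooth_on_det:
  fixes A :: "'b::real_normed_vector \<Rightarrow> real^'n^'n"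
  assumes "open U" "\<And>i j. smooth_on U (\<lambda>u. A u $ i $ j)"
  shows "smooth_on U (\<lambda>u. det (A u))"
  unfolding det_def
  by (intro smooth_on_sum smooth_on_mult smooth_on_prod smooth_on_const assms)

text \<open>Cramer's rule turns each entry of the inverse into a quotient of determinants, hence of
  polynomials in the entries; this is how the inverse metric becomes smooth.\<close>

lemma matrix_inv_cramer:
  fixes A :: "real^'n^'n"
  assumes "det A \<noteq> 0"
  shows "matrix_inv A $ i $ j = det (\<chi> k l. if l = i then axis j 1 $ k else A $ k $ l) / det A"
proof -
  have "invertible A" using assms invertible_det_nz by blast
  then have "A ** matrix_inv A = mat 1"
    unfolding matrix_inv_def invertible_def by (rule someI2_ex) auto
  then have "A *v column j (matrix_inv A) = axis j 1"
    by (metis matrix_vector_mul_assoc matrix_vector_mul_lid matrix_vector_mult_basis)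
  then have "column j (matrix_inv A) = (\<chi> k. det (\<chi> i l. if l = k then axis j 1 $ i else A $ i $ l) / det A)"
    using cramer[OF assms] by blast
  then have "column j (matrix_inv A) $ i = (\<chi> k. det (\<chi> i l. if l = k then axis j 1 $ i else A $ i $ l) / det A) $ i"
    by (rule arg_cong)
  then show ?thesis unfolding column_def by (simp only: vec_lambda_beta)
qed

lemma smooth_on_matrix_inv:
  fixes A :: "'b::real_normed_vector \<Rightarrow> real^'n^'n"
  assumes "open U" "\<And>i j. smooth_on U (\<lambda>u. A u $ i $ j)" "\<And>u. u \<in> U \<Longrightarrow> det (A u) \<noteq> 0"
  shows "smooth_on U (\<lambda>u. matrix_inv (A u) $ i $ j)"
proof (rule smooth_on_cong[OF assms(1)])
  show "smooth_on U (\<lambda>u. det (\<chi> k l. if l = i then axis j 1 $ k else A u $ k $ l) / det (A u))"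
  proof (rule smooth_on_divide[OF assms(1) smooth_on_det[OF assms(1)] smooth_on_det[OF assms(1)]])
    fix k l
    show "smooth_on U (\<lambda>u. (\<chi> k l. if l = i then axis j 1 $ k else A u $ k $ l) $ k $ l)"
      by (cases "l = i") (simp_all add: smooth_on_const assms(2))
  qed (use assms in auto)
qed (use assms(3) in \<open>simp add: matrix_inv_cramer\<close>)

section \<open>Symmetry of second derivatives\<close>

lemma second_difference:
  fixes f :: "'b::real_normed_vector \<Rightarrow> real"
  assumes "\<And>s t. 0 \<le> s \<Longrightarrow> s \<le> d \<Longrightarrow> 0 \<le> t \<Longrightarrow> t \<le> d \<Longrightarrow> u + s *\<^sub>R h + t *\<^sub>R k \<in> U"
    and f: "C_on (Suc (Suc 0)) U f" and d: "0 < d"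
  obtains s t where "0 \<le> s" "s \<le> d" "0 \<le> t" "t \<le> d"
    and "f (u + d *\<^sub>R h + d *\<^sub>R k) - f (u + d *\<^sub>R h) - f (u + d *\<^sub>R k) + f u =
      d * d * frechet_derivative (\<lambda>u. frechet_derivative f (at u) h) (at (u + s *\<^sub>R h + t *\<^sub>R k)) k"
proof -
  have line: "((\<lambda>t. g (v + t *\<^sub>R w)) has_real_derivative frechet_derivative g (at (v + t *\<^sub>R w)) w) (at t)"
    if "g differentiable (at (v + t *\<^sub>R w))" for g :: "'b \<Rightarrow> real" and v w t
  proof -
    have "(g has_derivative frechet_derivative g (at (v + t *\<^sub>R w))) (at (v + t *\<^sub>R w))"
      using that by (simp add: frechet_derivative_works)
    then have "((\<lambda>t. g (v + t *\<^sub>R w)) has_derivative (\<lambda>s. frechet_derivative g (at (v + t *\<^sub>R w)) (s *\<^sub>R w))) (at t)"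
      by (rule has_derivative_compose[rotated]) (auto intro!: derivative_eq_intros)
    then show ?thesis
      unfolding has_field_derivative_def
      by (rule has_derivative_eq_rhs)
        (simp add: linear_scale[OF linear_frechet_derivative[OF that]] fun_eq_iff)
  qed
  let ?D = "\<lambda>v. frechet_derivative f (at v) h"
  have f1: "f differentiable (at v)" "?D differentiable (at v)" if "v \<in> U" for v
    using f that by auto
  \<comment> \<open>The second difference is the increment of \<phi> over [0, d]. The mean value
    theorem is used for \<phi> in the direction \<open>h\<close>, then for the derivative so
    obtained in the direction \<open>k\<close>.\<close>
  define \<phi> where "\<phi> = (\<lambda>s. f ((u + d *\<^sub>R k) + s *\<^sub>R h) - f (u + s *\<^sub>R h))"
  have U1: "(u + d *\<^sub>R k) + s *\<^sub>R h \<in> U" "u + s *\<^sub>R h \<in> U" if "0 \<le> s" "s \<le> d" for s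
    using assms(1)[of s d] assms(1)[of s 0] that d by (auto simp: algebra_simps)
  have "(\<phi> has_real_derivative (?D ((u + d *\<^sub>R k) + s *\<^sub>R h) - ?D (u + s *\<^sub>R h))) (at s)"
    if "0 \<le> s" "s \<le> d" for s
    unfolding \<phi>_def using U1[OF that] f1 by (intro DERIV_diff line) auto
  from MVT2[OF d this] obtain s where s: "0 < s" "s < d"
    "\<phi> d - \<phi> 0 = d * (?D ((u + d *\<^sub>R k) + s *\<^sub>R h) - ?D (u + s *\<^sub>R h))" by auto
  have "((\<lambda>t. ?D ((u + s *\<^sub>R h) + t *\<^sub>R k)) has_real_derivative
      frechet_derivative ?D (at ((u + s *\<^sub>R h) + t *\<^sub>R k)) k) (at t)" if "0 \<le> t" "t \<le> d" for t
    using assms(1)[of s t] that s f1 by (intro line) auto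
  from MVT2[OF d this] obtain t where t: "0 < t" "t < d"
    "?D ((u + s *\<^sub>R h) + d *\<^sub>R k) - ?D ((u + s *\<^sub>R h) + 0 *\<^sub>R k)
      = d * frechet_derivative ?D (at ((u + s *\<^sub>R h) + t *\<^sub>R k)) k" by auto
  have "f (u + d *\<^sub>R h + d *\<^sub>R k) - f (u + d *\<^sub>R h) - f (u + d *\<^sub>R k) + f u = \<phi> d - \<phi> 0"
    by (simp add: \<phi>_def algebra_simps)
  also have "\<dots> = d * d * frechet_derivative ?D (at (u + s *\<^sub>R h + t *\<^sub>R k)) k"
    using s(3) t(3) by (simp add: add.commute add.left_commute)
  finally show thesis using s t by (intro that[of s t]) auto
qed

text \<open>The second difference is symmetric in \<open>h\<close> and \<open>k\<close>, so the two
  mixed derivatives agree at suitable points arbitrarily near \<open>u\<close>; continuity carries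
  the equality to \<open>u\<close>.\<close>

lemma frechet_derivative_commute_real:
  fixes f :: "'b::real_normed_vector \<Rightarrow> real"
  assumes U: "open U" "u \<in> U" and f: "C_on (Suc (Suc 0)) U f"
  shows "frechet_derivative (\<lambda>u. frechet_derivative f (at u) h) (at u) k
    = frechet_derivative (\<lambda>u. frechet_derivative f (at u) k) (at u) h"
proof -
  let ?P = "\<lambda>h k v. frechet_derivative (\<lambda>u. frechet_derivative f (at u) h) (at v) k"
  have cont: "continuous_on U (?P h k)" for h k using f by simp
  have "\<bar>?P h k u - ?P k h u\<bar> < 2 * \<epsilon>" if \<epsilon>: "\<epsilon> > 0" for \<epsilon>
  proof -
    have "\<exists>r>0. \<forall>v\<in>ball u r. v \<in> U \<and> \<bar>?P h k v - ?P h k u\<bar> < \<epsilon>" for h k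
    proof -
      obtain r1 where "r1 > 0" "\<forall>v. dist v u < r1 \<longrightarrow> v \<in> U" using U unfolding open_dist by blast
      moreover obtain r2 where "r2 > 0" "\<forall>v\<in>U. dist v u < r2 \<longrightarrow> dist (?P h k v) (?P h k u) < \<epsilon>"
        using cont[of h k] U(2) \<epsilon> unfolding continuous_on_iff by blast
      ultimately show ?thesis
        by (intro exI[of _ "min r1 r2"]) (auto simp: dist_commute dist_real_def)
    qed
    then obtain r1 r2 where r: "r1 > 0" "\<forall>v\<in>ball u r1. v \<in> U \<and> \<bar>?P h k v - ?P h k u\<bar> < \<epsilon>"
      "r2 > 0" "\<forall>v\<in>ball u r2. v \<in> U \<and> \<bar>?P k h v - ?P k h u\<bar> < \<epsilon>" by metis
    \<comment> \<open>The summand 1 keeps \<open>q\<close> positive when \<open>h\<close> and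
      \<open>k\<close> vanish; \<open>d\<close> is then small enough to put the whole parallelogram
      into both balls.\<close>
    define q where "q = norm h + norm k + 1"
    define d where "d = min r1 r2 / (2 * q)"
    have pos: "q > 0" by (simp add: q_def add_nonneg_pos)
    then have d: "d > 0" using r by (simp add: d_def)
    have near: "u + s *\<^sub>R h + t *\<^sub>R k \<in> ball u r1 \<inter> ball u r2"
      if "0 \<le> s" "s \<le> d" "0 \<le> t" "t \<le> d" for s t
    proof -
      have "norm (s *\<^sub>R h + t *\<^sub>R k) \<le> s * norm h + t * norm k"
        using norm_triangle_ineq[of "s *\<^sub>R h" "t *\<^sub>R k"] that by simp
      also have "\<dots> \<le> d * norm h + d * norm k"
        using that by (intro add_mono mult_right_mono) auto
      also have "\<dots> < d * q" using d by (simp add: q_def algebra_simps)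
      also have "\<dots> < 2 * d * q" using d pos by simp
      also have "\<dots> = min r1 r2" using pos by (simp add: d_def)
      finally have "dist (u + s *\<^sub>R h + t *\<^sub>R k) u < min r1 r2"
        by (simp add: dist_norm add.assoc)
      then show ?thesis by (simp add: dist_commute)
    qed
    have near': "u + s *\<^sub>R k + t *\<^sub>R h \<in> ball u r1 \<inter> ball u r2"
      if "0 \<le> s" "s \<le> d" "0 \<le> t" "t \<le> d" for s t
      using near[OF that(3,4) that(1,2)] by (simp add: ac_simps)
    obtain s t where 1: "0 \<le> s" "s \<le> d" "0 \<le> t" "t \<le> d"
      "f (u + d *\<^sub>R h + d *\<^sub>R k) - f (u + d *\<^sub>R h) - f (u + d *\<^sub>R k) + f u = d * d * ?P h k (u + s *\<^sub>R h + t *\<^sub>R k)"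
      using second_difference[of d u h k U f] near r f d by blast
    obtain s' t' where 2: "0 \<le> s'" "s' \<le> d" "0 \<le> t'" "t' \<le> d"
      "f (u + d *\<^sub>R k + d *\<^sub>R h) - f (u + d *\<^sub>R k) - f (u + d *\<^sub>R h) + f u = d * d * ?P k h (u + s' *\<^sub>R k + t' *\<^sub>R h)"
      using second_difference[of d u k h U f] near' r f d by blast
    have "u + d *\<^sub>R h + d *\<^sub>R k = u + d *\<^sub>R k + d *\<^sub>R h" by simp
    then have "f (u + d *\<^sub>R h + d *\<^sub>R k) = f (u + d *\<^sub>R k + d *\<^sub>R h)" by (rule arg_cong)
    with 1(5) 2(5) have "d * d * ?P h k (u + s *\<^sub>R h + t *\<^sub>R k) = d * d * ?P k h (u + s' *\<^sub>R k + t' *\<^sub>R h)"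
      by argo
    then have "?P h k (u + s *\<^sub>R h + t *\<^sub>R k) = ?P k h (u + s' *\<^sub>R k + t' *\<^sub>R h)" using d by simp
    moreover have "\<bar>?P h k (u + s *\<^sub>R h + t *\<^sub>R k) - ?P h k u\<bar> < \<epsilon>" using near[OF 1(1-4)] r by blast
    moreover have "\<bar>?P k h (u + s' *\<^sub>R k + t' *\<^sub>R h) - ?P k h u\<bar> < \<epsilon>" using near'[OF 2(1-4)] r by blast
    ultimately show ?thesis by argo
  qed
  from this[of "\<bar>?P h k u - ?P k h u\<bar> / 2"] show ?thesis by (cases "?P h k u = ?P k h u") auto
qed

lemma frechet_derivative_commute:
  fixes f :: "'b::real_normed_vector \<Rightarrow> 'a::euclidean_space"
  assumes U: "open U" "u \<in> U" and f: "smooth_on U f"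
  shows "frechet_derivative (\<lambda>u. frechet_derivative f (at u) h) (at u) k
    = frechet_derivative (\<lambda>u. frechet_derivative f (at u) k) (at u) h"
proof (rule euclidean_eqI)
  fix b :: 'a
  have inner: "frechet_derivative (\<lambda>u. g u \<bullet> b) (at v) l = frechet_derivative g (at v) l \<bullet> b"
    if "smooth_on U g" "v \<in> U" for g :: "'b \<Rightarrow> 'a" and v l
  proof -
    have "(g has_derivative frechet_derivative g (at v)) (at v)"
      using smooth_on_differentiable[OF that] by (simp flip: frechet_derivative_works)
    from bounded_linear.has_derivative[OF bounded_linear_inner_left this]
    show ?thesis by (rule fun_cong[OF frechet_derivative_at[symmetric]])
  qed
  have "frechet_derivative (\<lambda>u. frechet_derivative f (at u) h) (at u) k \<bullet> b
    = frechet_derivative (\<lambda>u. frechet_derivative (\<lambda>u. f u \<bullet> b) (at u) h) (at u) k" for h k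
  proof -
    have "frechet_derivative (\<lambda>u. frechet_derivative f (at u) h) (at u) k \<bullet> b
        = frechet_derivative (\<lambda>u. frechet_derivative f (at u) h \<bullet> b) (at u) k"
      by (rule inner[symmetric, OF smooth_on_frechet_derivative[OF f] U(2)])
    also have "\<dots> = frechet_derivative (\<lambda>u. frechet_derivative (\<lambda>u. f u \<bullet> b) (at u) h) (at u) k"
      by (rule fun_cong[OF frechet_derivative_transform_within_open[OF _ U], symmetric])
        (simp_all add: inner[OF f]
          smooth_on_differentiable[OF smooth_on_frechet_derivative[OF smooth_on_inner[OF U(1) f smooth_on_const]] U(2)])
    finally show ?thesis .
  qed
  moreover have "C_on (Suc (Suc 0)) U (\<lambda>u. f u \<bullet> b)"
    using smooth_on_inner[OF U(1) f smooth_on_const] unfolding smooth_on_def by blast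
  ultimately show "frechet_derivative (\<lambda>u. frechet_derivative f (at u) h) (at u) k \<bullet> b
    = frechet_derivative (\<lambda>u. frechet_derivative f (at u) k) (at u) h \<bullet> b"
    using frechet_derivative_commute_real[OF U] by metis
qed

section \<open>Partial derivatives\<close>

lemma pderiv_at_commute:
  fixes w :: "real^'m \<Rightarrow> 'a::euclidean_space"
  assumes "open U" "u \<in> U" "smooth_on U w"
  shows "pderiv_at i (pderiv_at j w) u = pderiv_at j (pderiv_at i w) u"
  unfolding pderiv_at_def[abs_def] using frechet_derivative_commute[OF assms] .

lemma pderiv_at_cong:
  assumes "open U" "u \<in> U" "\<And>v. v \<in> U \<Longrightarrow> w v = w' v" "w differentiable (at u)"
  shows "pderiv_at i w u = pderiv_at i w' u"
  unfolding pderiv_at_def using frechet_derivative_transform_within_open[OF assms(4,1,2,3)] by simp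

lemma pderiv_at_const [simp]: "pderiv_at i (\<lambda>v. c) u = 0"
  by (simp add: pderiv_at_def)

lemma pderiv_at_eq: "(w has_derivative w') (at u) \<Longrightarrow> pderiv_at i w u = w' (axis i 1)"
  unfolding pderiv_at_def by (drule frechet_derivative_at) simp

lemma pderiv_at_add:
  "w differentiable (at u) \<Longrightarrow> w' differentiable (at u) \<Longrightarrow>
    pderiv_at i (\<lambda>v. w v + w' v) u = pderiv_at i w u + pderiv_at i w' u"
  unfolding frechet_derivative_works by (drule (1) has_derivative_add, drule pderiv_at_eq) (simp add: pderiv_at_def)

lemma pderiv_at_minus:
  "w differentiable (at u) \<Longrightarrow> pderiv_at i (\<lambda>v. - w v) u = - pderiv_at i w u"
  unfolding frechet_derivative_works by (drule has_derivative_minus, drule pderiv_at_eq) (simp add: pderiv_at_def)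

lemma pderiv_at_diff:
  "w differentiable (at u) \<Longrightarrow> w' differentiable (at u) \<Longrightarrow>
    pderiv_at i (\<lambda>v. w v - w' v) u = pderiv_at i w u - pderiv_at i w' u"
  unfolding frechet_derivative_works by (drule (1) has_derivative_diff, drule pderiv_at_eq) (simp add: pderiv_at_def)

lemma pderiv_at_bilinear:
  assumes "bounded_bilinear B" "w differentiable (at u)" "w' differentiable (at u)"
  shows "pderiv_at i (\<lambda>v. B (w v) (w' v)) u = B (w u) (pderiv_at i w' u) + B (pderiv_at i w u) (w' u)"
  using pderiv_at_eq[OF bounded_bilinear.FDERIV[OF assms(1) assms(2,3)[unfolded frechet_derivative_works]]]
  by (simp add: pderiv_at_def)

lemma pderiv_at_inner:
  "w differentiable (at u) \<Longrightarrow> w' differentiable (at u) \<Longrightarrow>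
    pderiv_at i (\<lambda>v. w v \<bullet> w' v) u = pderiv_at i w u \<bullet> w' u + w u \<bullet> pderiv_at i w' u"
  using pderiv_at_bilinear[OF bounded_bilinear_inner] by (simp add: add.commute)

lemma pderiv_at_scaleR:
  "\<phi> differentiable (at u) \<Longrightarrow> w differentiable (at u) \<Longrightarrow>
    pderiv_at i (\<lambda>v. \<phi> v *\<^sub>R w v) u = pderiv_at i \<phi> u *\<^sub>R w u + \<phi> u *\<^sub>R pderiv_at i w u"
  using pderiv_at_bilinear[OF bounded_bilinear_scaleR] by (simp add: add.commute)

lemma pderiv_at_mult:
  fixes \<phi> \<psi> :: "real^'m \<Rightarrow> real"
  shows "\<phi> differentiable (at u) \<Longrightarrow> \<psi> differentiable (at u) \<Longrightarrow>
    pderiv_at i (\<lambda>v. \<phi> v * \<psi> v) u = pderiv_at i \<phi> u * \<psi> u + \<phi> u * pderiv_at i \<psi> u"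
  using pderiv_at_bilinear[OF bounded_bilinear_mult] by (simp add: add.commute)

lemma pderiv_at_sum:
  assumes "\<And>k. k \<in> I \<Longrightarrow> w k differentiable (at u)"
  shows "pderiv_at i (\<lambda>v. \<Sum>k\<in>I. w k v) u = (\<Sum>k\<in>I. pderiv_at i (w k) u)"
  using pderiv_at_eq[OF has_derivative_sum[OF assms[unfolded frechet_derivative_works]]]
  by (simp add: pderiv_at_def)

lemma frechet_derivative_expand:
  fixes w :: "real^'m \<Rightarrow> 'a::real_normed_vector"
  assumes "w differentiable (at u)"
  shows "frechet_derivative w (at u) h = (\<Sum>i\<in>UNIV. h $ i *\<^sub>R pderiv_at i w u)"
proof -
  note lin = linear_frechet_derivative[OF assms]
  have "h = (\<Sum>j\<in>UNIV. h $ j *\<^sub>R axis j 1)"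
    using basis_expansion[of h] by (simp add: scalar_mult_eq_scaleR)
  then have "frechet_derivative w (at u) h = frechet_derivative w (at u) (\<Sum>j\<in>UNIV. h $ j *\<^sub>R axis j 1)" by simp
  then show ?thesis by (simp add: linear_sum[OF lin] linear_scale[OF lin] pderiv_at_def)
qed

section \<open>Self-adjoint operators with at most two eigenvalues\<close>

text \<open>A maximum point of the Rayleigh quotient on the unit sphere of \<open>W\<close> is an
  eigenvector.\<close>

lemma self_adjoint_eigenvector:
  fixes L :: "'a::euclidean_space \<Rightarrow> 'a"
  assumes W: "subspace W" "W \<noteq> {0}" and L: "linear L" "\<And>w. w \<in> W \<Longrightarrow> L w \<in> W"
    and sym: "\<And>v w. v \<in> W \<Longrightarrow> w \<in> W \<Longrightarrow> L v \<bullet> w = v \<bullet> L w"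
  obtains c w where "w \<in> W" "w \<noteq> 0" "L w = c *\<^sub>R w"
proof -
  have contL: "continuous_on A L" for A using L(1) by (simp add: linear_continuous_on linear_linear)
  obtain w0 where w0: "w0 \<in> W" "w0 \<noteq> 0" using W subspace_0 by blast
  then have "w0 /\<^sub>R norm w0 \<in> W \<inter> sphere 0 1" using W(1) by (simp add: subspace_scale)
  then have "W \<inter> sphere 0 1 \<noteq> {}" by blast
  moreover have "compact (W \<inter> sphere 0 1)"
    using closed_subspace[OF W(1)] by (simp add: compact_eq_bounded_closed closed_Int bounded_Int)
  moreover have "continuous_on (W \<inter> sphere 0 1) (\<lambda>w. L w \<bullet> w)"
    by (intro continuous_intros contL)
  ultimately obtain w where w': "w \<in> W \<inter> sphere 0 1" and max': "\<forall>v\<in>W \<inter> sphere 0 1. L v \<bullet> v \<le> L w \<bullet> w"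
    using continuous_attains_sup[of "W \<inter> sphere 0 1" "\<lambda>w. L w \<bullet> w"] by meson
  then have w: "w \<in> W" "norm w = 1" by auto
  have max: "L v \<bullet> v \<le> L w \<bullet> w" if "v \<in> W" "norm v = 1" for v using max' that by simp
  define c where "c = L w \<bullet> w"
  have ray: "L v \<bullet> v \<le> c * (v \<bullet> v)" if "v \<in> W" for v
  proof (cases "v = 0")
    case False
    have "L (v /\<^sub>R norm v) \<bullet> (v /\<^sub>R norm v) \<le> c"
      unfolding c_def using that False W(1) by (intro max) (auto simp: subspace_scale)
    then have "(L v \<bullet> v) / (norm v * norm v) \<le> c"
      by (simp add: linear_scale[OF L(1)] divide_inverse mult.assoc mult.commute mult.left_commute)
    then show ?thesis using False
      by (simp add: divide_le_eq dot_square_norm power2_eq_square)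
  qed (simp add: linear_0[OF L(1)])
  \<comment> \<open>The residual of the eigenvector equation. Moving \<open>w\<close> along it
    changes the nonnegative defect in \<open>ray\<close> by 2 t (v \<bullet> v) to first order,
    which is impossible at a minimum unless \<open>v\<close> is zero.\<close>
  define v where "v = c *\<^sub>R w - L w"
  have v: "v \<in> W" using w W(1) L(2) by (simp add: v_def subspace_diff subspace_scale)
  have ww: "w \<bullet> w = 1" using w(2) by (simp add: dot_square_norm)
  have wv: "w \<bullet> L v = L w \<bullet> v" using sym w(1) v by simp
  have q: "0 \<le> 2 * t * (v \<bullet> v) + t * t * (c * (v \<bullet> v) - L v \<bullet> v)" for t
  proof -
    have "w + t *\<^sub>R v \<in> W" using w(1) v W(1) by (simp add: subspace_add subspace_scale)
    from ray[OF this] have "0 \<le> c * ((w + t *\<^sub>R v) \<bullet> (w + t *\<^sub>R v)) - (L w + t *\<^sub>R L v) \<bullet> (w + t *\<^sub>R v)"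
      by (simp add: linear_add[OF L(1)] linear_scale[OF L(1)])
    also have "\<dots> = c * (1 + 2 * t * (w \<bullet> v) + t * t * (v \<bullet> v)) - (c + 2 * t * (L w \<bullet> v) + t * t * (L v \<bullet> v))"
      using wv by (simp add: inner_add_left inner_add_right c_def ww inner_commute algebra_simps)
    also have "\<dots> = 2 * t * ((c *\<^sub>R w - L w) \<bullet> v) + t * t * (c * (v \<bullet> v) - L v \<bullet> v)"
      by (simp add: inner_diff_left algebra_simps)
    finally show ?thesis by (simp add: v_def)
  qed
  have "v \<bullet> v = 0"
  proof (rule ccontr)
    assume "v \<bullet> v \<noteq> 0"
    then have pos: "v \<bullet> v > 0" by simp
    define a where "a = c * (v \<bullet> v) - L v \<bullet> v"
    have a: "a \<ge> 0" using ray[OF v] by (simp add: a_def)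
    \<comment> \<open>Negative, and small enough for the linear term to dominate; the 1 in the
      denominator covers \<open>a = 0\<close>.\<close>
    define t where "t = - (v \<bullet> v) / (a + 1)"
    have t: "t < 0" "t * (a + 1) = - (v \<bullet> v)" using pos a by (auto simp: t_def field_simps)
    have "t * a + t = - (v \<bullet> v)" using t(2) by (simp add: distrib_left)
    then have "2 * (v \<bullet> v) + t * a > 0" using t(1) pos by linarith
    then have "t * (2 * (v \<bullet> v) + t * a) < 0" using t(1) by (simp add: mult_neg_pos)
    with q[of t] show False by (simp add: a_def algebra_simps)
  qed
  then have "L w = c *\<^sub>R w" by (simp add: v_def)
  moreover have "w \<noteq> 0" using w(2) by auto
  ultimately show thesis using that w(1) by blast
qed

text \<open>The product of \<open>L\<close> - \<alpha> and \<open>L\<close> - \<beta> has an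
  \<open>L\<close>-invariant image. Were it nonzero, it would contain an eigenvector
  \<open>w = P a\<close>, which \<open>P\<close> kills, and self-adjointness gives w \<bullet> w = a
  \<bullet> P w = 0. No diagonalization is required.\<close>

lemma two_eigenvalues_quadratic:
  fixes L :: "'a::euclidean_space \<Rightarrow> 'a"
  assumes T: "subspace T" and L: "linear L" "\<And>w. w \<in> T \<Longrightarrow> L w \<in> T"
    and sym: "\<And>v w. v \<in> T \<Longrightarrow> w \<in> T \<Longrightarrow> L v \<bullet> w = v \<bullet> L w"
    and eig: "\<And>c w. w \<in> T \<Longrightarrow> w \<noteq> 0 \<Longrightarrow> L w = c *\<^sub>R w \<Longrightarrow> c = \<alpha> \<or> c = \<beta>"
    and v: "v \<in> T"
  shows "L (L v) = (\<alpha> + \<beta>) *\<^sub>R L v - (\<alpha> * \<beta>) *\<^sub>R v"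
proof -
  define P where "P w = L (L w) - (\<alpha> + \<beta>) *\<^sub>R L w + (\<alpha> * \<beta>) *\<^sub>R w" for w
  note lin = linear_add[OF L(1)] linear_scale[OF L(1)] linear_diff[OF L(1)]
  have P: "linear P"
    by (rule linearI) (simp_all add: P_def lin algebra_simps)
  have PT: "P w \<in> T" if "w \<in> T" for w
    using that T L(2) by (simp add: P_def subspace_add subspace_diff subspace_scale)
  have LP: "L (P w) = P (L w)" for w by (simp add: P_def lin)
  have Psym: "P a \<bullet> b = a \<bullet> P b" if "a \<in> T" "b \<in> T" for a b
    using that sym L(2) by (simp add: P_def inner_simps)
  have W: "subspace (P ` T)" using P T by (rule linear_subspace_image)
  have "P ` T = {0}"
  proof (rule ccontr)
    assume "P ` T \<noteq> {0}"
    moreover have "L w \<in> P ` T" if "w \<in> P ` T" for w using that L(2) LP by auto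
    moreover have "L v \<bullet> w = v \<bullet> L w" if "v \<in> P ` T" "w \<in> P ` T" for v w using that sym PT by auto
    ultimately obtain c w where w: "w \<in> P ` T" "w \<noteq> 0" "L w = c *\<^sub>R w"
      using self_adjoint_eigenvector[OF W _ L(1)] by metis
    then obtain a where a: "a \<in> T" "w = P a" by blast
    have "w \<in> T" using a PT by simp
    have "c = \<alpha> \<or> c = \<beta>" using eig \<open>w \<in> T\<close> w by blast
    moreover have "P w = ((c - \<alpha>) * (c - \<beta>)) *\<^sub>R w"
      by (simp add: P_def w(3) lin algebra_simps)
    ultimately have "P w = 0" by auto
    then have "w \<bullet> w = 0" using Psym[OF a(1) \<open>w \<in> T\<close>] a(2) by simp
    with w(2) show False by simp
  qed
  then have "P v = 0" using v by blast
  then show ?thesis by (simp add: P_def algebra_simps)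
qed

section \<open>Calculus on a parametrized submanifold\<close>

text \<open>Coordinates of the tangential part of an arbitrary ambient vector in the coordinate
  frame; they let traces be taken as sums of diagonal entries.\<close>

definition tangent_coord :: "(real^'m::finite \<Rightarrow> 'a::euclidean_space) \<Rightarrow> real^'m \<Rightarrow> 'a \<Rightarrow> 'm \<Rightarrow> real" where
  "tangent_coord x u w i = (\<Sum>j\<in>UNIV. metric_inv x u $ i $ j * (w \<bullet> pderiv_at j x u))"

definition gradient_coord :: "(real^'m::finite \<Rightarrow> 'a::euclidean_space) \<Rightarrow> (real^'m \<Rightarrow> real) \<Rightarrow> real^'m \<Rightarrow> 'm \<Rightarrow> real" where
  "gradient_coord x \<phi> u i = (\<Sum>j\<in>UNIV. metric_inv x u $ i $ j * pderiv_at j \<phi> u)"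

text \<open>Meant for functions with values in a fixed vector space, in particular for ambient
  fields componentwise. The sign is that of the trace of the Hessian, opposite to
  \<open>rough_laplacian\<close>.\<close>

definition laplace_beltrami ::
    "(real^'m::finite \<Rightarrow> 'a::euclidean_space) \<Rightarrow> (real^'m \<Rightarrow> 'b::real_normed_vector) \<Rightarrow> real^'m \<Rightarrow> 'b" where
  "laplace_beltrami x w u = metric_trace x u (\<lambda>i j. pderiv_at i (pderiv_at j w) u
     - (\<Sum>k\<in>UNIV. christoffel x k i j u *\<^sub>R pderiv_at k w u))"

lemma metric_trace_add: "metric_trace x u (\<lambda>i j. S i j + T i j) = metric_trace x u S + metric_trace x u T"
  by (simp add: metric_trace_def scaleR_add_right sum.distrib)

lemma metric_trace_diff: "metric_trace x u (\<lambda>i j. S i j - T i j) = metric_trace x u S - metric_trace x u T"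
  by (simp add: metric_trace_def scaleR_diff_right sum_subtractf)

lemma metric_trace_scaleR: "metric_trace x u (\<lambda>i j. c *\<^sub>R T i j) = c *\<^sub>R metric_trace x u T"
  by (simp add: metric_trace_def scaleR_sum_right mult.commute)

lemma metric_trace_mult: "metric_trace x u (\<lambda>i j. c * T i j) = c * metric_trace x u T" for c :: real
  using metric_trace_scaleR[of x u c T] by simp

lemma metric_trace_uminus: "metric_trace x u (\<lambda>i j. - T i j) = - metric_trace x u T"
  using metric_trace_diff[of x u "\<lambda>_ _. 0" T] by (simp add: metric_trace_def)

lemma metric_trace_scaleR_left: "metric_trace x u (\<lambda>i j. T i j *\<^sub>R w) = metric_trace x u T *\<^sub>R w"
  by (simp add: metric_trace_def scaleR_sum_left)

lemma metric_trace_inner: "metric_trace x u T \<bullet> w = metric_trace x u (\<lambda>i j. T i j \<bullet> w)"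
  by (simp add: metric_trace_def inner_sum_left)

lemma metric_trace_cong: "(\<And>i j. S i j = T i j) \<Longrightarrow> metric_trace x u S = metric_trace x u T"
  by (simp add: metric_trace_def)

lemma tangent_coord_add: "tangent_coord x u (v + w) i = tangent_coord x u v i + tangent_coord x u w i"
  by (simp add: tangent_coord_def inner_add_left distrib_left sum.distrib)

lemma tangent_coord_scaleR: "tangent_coord x u (c *\<^sub>R w) i = c * tangent_coord x u w i"
  by (simp add: tangent_coord_def sum_distrib_left algebra_simps)

lemma tangent_coord_sum_left: "tangent_coord x u (\<Sum>k\<in>K. w k) i = (\<Sum>k\<in>K. tangent_coord x u (w k) i)"
  unfolding tangent_coord_def inner_sum_left sum_distrib_left by (rule sum.swap)

lemma tangent_part_sum_left: "tangent_part x u (\<Sum>k\<in>K. w k) = (\<Sum>k\<in>K. tangent_part x u (w k))"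
proof (induction K rule: infinite_finite_induct)
  case (insert k K)
  then show ?case by (simp add: tangent_part_def inner_add_left scaleR_add_left metric_trace_add)
qed (simp_all add: tangent_part_def metric_trace_def)

locale patch =
  fixes U :: "(real^'m::finite) set" and x :: "real^'m \<Rightarrow> 'a::euclidean_space"
  assumes open_U: "open U" and smooth_x: "smooth_on U x"
    and inj_dx: "\<And>u. u \<in> U \<Longrightarrow> inj (frechet_derivative x (at u))"
    and on_sphere: "\<And>u. u \<in> U \<Longrightarrow> x u \<bullet> x u = 1"
begin

abbreviation e where "e i \<equiv> pderiv_at i x"
abbreviation dd where "dd i j w \<equiv> pderiv_at i (pderiv_at j w)"
abbreviation \<Gamma> where "\<Gamma> k i j u \<equiv> christoffel x k i j u"
abbreviation tr where "tr u T \<equiv> metric_trace x u T"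
abbreviation \<Delta> where "\<Delta> w u \<equiv> laplace_beltrami x w u"

lemmas smooth_intros = smooth_on_const smooth_on_add[OF open_U] smooth_on_diff[OF open_U]
  smooth_on_minus[OF open_U] smooth_on_mult[OF open_U] smooth_on_scaleR[OF open_U]
  smooth_on_inner[OF open_U] smooth_on_sum[OF open_U] smooth_on_pderiv_at smooth_x

lemmas diff_at = smooth_on_differentiable[where U=U]

section \<open>The metric, its inverse and the tangential projection\<close>

lemma dx_expand: "u \<in> U \<Longrightarrow> frechet_derivative x (at u) h = (\<Sum>i\<in>UNIV. h $ i *\<^sub>R e i u)"
  by (rule frechet_derivative_expand[OF diff_at[OF smooth_x]])

lemma independent:
  assumes "u \<in> U" "(\<Sum>i\<in>UNIV. c i *\<^sub>R e i u) = 0"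
  shows "c i = 0"
proof -
  have "frechet_derivative x (at u) (\<chi> i. c i) = frechet_derivative x (at u) 0"
    using assms by (simp add: dx_expand)
  then have "(\<chi> i. c i) = 0" using inj_dx[OF assms(1)] by (simp add: inj_def)
  then show ?thesis by (simp add: vec_eq_iff)
qed

lemma invertible_metric:
  assumes "u \<in> U" shows "invertible (induced_metric x u)"
proof -
  have "h = 0" if "induced_metric x u *v h = 0" for h
  proof -
    have "(\<Sum>i\<in>UNIV. h $ i *\<^sub>R e i u) \<bullet> (\<Sum>i\<in>UNIV. h $ i *\<^sub>R e i u) = (\<Sum>i\<in>UNIV. h $ i * (induced_metric x u *v h) $ i)"
      by (simp add: induced_metric_def matrix_vector_mult_def inner_sum_left inner_sum_right sum_distrib_left algebra_simps inner_commute)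
    then have "(\<Sum>i\<in>UNIV. h $ i *\<^sub>R e i u) = 0" using that by simp
    from independent[OF assms this] show ?thesis by (simp add: vec_eq_iff)
  qed
  then show ?thesis by (simp add: invertible_left_inverse matrix_left_invertible_ker)
qed

lemma metric_inv_mult:
  assumes "u \<in> U"
  shows "metric_inv x u ** induced_metric x u = mat 1"
  using invertible_metric[OF assms] unfolding metric_inv_def matrix_inv_def invertible_def
  by (rule someI2_ex) auto

lemma metric_inv_sym:
  assumes "u \<in> U"
  shows "metric_inv x u $ i $ j = metric_inv x u $ j $ i"
proof -
  let ?g = "induced_metric x u" and ?h = "metric_inv x u"
  have "transpose ?g = ?g" by (simp add: induced_metric_def transpose_def inner_commute vec_eq_iff)
  then have "?g ** transpose ?h = mat 1"
    using arg_cong[OF metric_inv_mult[OF assms], of transpose] by (simp add: matrix_transpose_mul)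
  then have "?h ** (?g ** transpose ?h) = ?h" by simp
  then have "transpose ?h = ?h"
    by (simp add: matrix_mul_assoc metric_inv_mult[OF assms])
  then have "transpose ?h $ j $ i = ?h $ j $ i" by simp
  then show ?thesis by (simp add: transpose_def)
qed

lemma metric_inv_delta:
  assumes "u \<in> U"
  shows "(\<Sum>j\<in>UNIV. metric_inv x u $ i $ j * (e j u \<bullet> e k u)) = (if i = k then 1 else 0)"
proof -
  have "(metric_inv x u ** induced_metric x u) $ i $ k = (mat 1 :: real^'m^'m) $ i $ k"
    by (simp only: metric_inv_mult[OF assms])
  then show ?thesis by (simp add: matrix_matrix_mult_def induced_metric_def mat_def)
qed

lemma smooth_metric_inv: "smooth_on U (\<lambda>u. metric_inv x u $ i $ j)"
  unfolding metric_inv_def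
proof (rule smooth_on_matrix_inv[OF open_U])
  show "smooth_on U (\<lambda>u. induced_metric x u $ i $ j)" for i j
    unfolding induced_metric_def by (simp, intro smooth_intros)
  show "det (induced_metric x u) \<noteq> 0" if "u \<in> U" for u
    using invertible_metric[OF that] invertible_det_nz by blast
qed

lemma smooth_tangent_coord: "smooth_on U w \<Longrightarrow> smooth_on U (\<lambda>u. tangent_coord x u (w u) i)"
  unfolding tangent_coord_def by (intro smooth_intros smooth_metric_inv)

lemma smooth_gradient_coord: "smooth_on U \<phi> \<Longrightarrow> smooth_on U (\<lambda>u. gradient_coord x \<phi> u i)"
  unfolding gradient_coord_def by (intro smooth_intros smooth_metric_inv)

lemma smooth_metric_trace:
  "(\<And>i j. smooth_on U (\<lambda>u. T u i j)) \<Longrightarrow> smooth_on U (\<lambda>u. tr u (T u))"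
  unfolding metric_trace_def by (intro smooth_intros smooth_metric_inv)

lemma tangent_part_coord: "tangent_part x u w = (\<Sum>i\<in>UNIV. tangent_coord x u w i *\<^sub>R e i u)" if "u \<in> U"
  unfolding tangent_part_def metric_trace_def tangent_coord_def
  by (subst sum.swap) (simp add: scaleR_sum_left metric_inv_sym[OF that])

lemma tangent_coord_sum:
  assumes "u \<in> U" shows "tangent_coord x u (\<Sum>k\<in>UNIV. c k *\<^sub>R e k u) i = c i"
proof -
  have "tangent_coord x u (\<Sum>k\<in>UNIV. c k *\<^sub>R e k u) i =
    (\<Sum>k\<in>UNIV. c k * (\<Sum>j\<in>UNIV. metric_inv x u $ i $ j * (e k u \<bullet> e j u)))"
    unfolding tangent_coord_def inner_sum_left sum_distrib_left
    by (subst sum.swap) (simp add: algebra_simps)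
  also have "\<dots> = (\<Sum>k\<in>UNIV. c k * (if i = k then 1 else 0))"
    using metric_inv_delta[OF assms] by (simp add: inner_commute)
  finally show ?thesis by (simp add: if_distrib cong: if_cong)
qed

lemma tangent_part_sum:
  assumes "u \<in> U" shows "tangent_part x u (\<Sum>k\<in>UNIV. c k *\<^sub>R e k u) = (\<Sum>k\<in>UNIV. c k *\<^sub>R e k u)"
  by (simp add: tangent_part_coord[OF assms] tangent_coord_sum[OF assms])

lemma tangent_part_normal:
  "(\<And>i. w \<bullet> e i u = 0) \<Longrightarrow> tangent_part x u w = 0"
  by (simp add: tangent_part_def metric_trace_def)

lemma tangent_part_add: "tangent_part x u (v + w) = tangent_part x u v + tangent_part x u w"
  by (simp add: tangent_part_def inner_add_left scaleR_add_left metric_trace_add)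

lemma tangent_part_scaleR: "tangent_part x u (c *\<^sub>R w) = c *\<^sub>R tangent_part x u w"
  by (simp add: tangent_part_def metric_trace_scaleR[symmetric])

lemma tangent_part_inner_e:
  assumes "u \<in> U" shows "tangent_part x u w \<bullet> e k u = w \<bullet> e k u"
  using tangent_part_orthogonal_projection(2)[OF diff_at[OF smooth_x assms] inj_dx[OF assms], of "e k u" w]
  by (simp add: pderiv_at_def inner_diff_left)

lemma tr_inner_e:
  assumes "u \<in> U"
  shows "tr u (\<lambda>i j. a i \<bullet> e j u) = (\<Sum>i\<in>UNIV. tangent_coord x u (a i) i)"
  by (simp add: metric_trace_def tangent_coord_def)

lemma tr_metric:
  assumes "u \<in> U" shows "tr u (\<lambda>i j. e i u \<bullet> e j u) = real CARD('m)"
proof -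
  have "tangent_coord x u (e i u) i = 1" for i
    using metric_inv_delta[OF assms, of i i] by (simp add: tangent_coord_def inner_commute)
  then show ?thesis by (simp add: tr_inner_e[OF assms])
qed

lemma tr_tensor:
  assumes "u \<in> U"
  shows "tr u (\<lambda>i j. (a \<bullet> e i u) * (b \<bullet> e j u)) = tangent_part x u a \<bullet> b"
  by (simp add: tangent_part_def metric_trace_inner inner_commute[of b])

section \<open>The position vector and the second derivatives of \<open>x\<close>\<close>

lemma x_inner_e: assumes "u \<in> U" shows "x u \<bullet> e i u = 0"
proof -
  have "pderiv_at i (\<lambda>v. x v \<bullet> x v) u = pderiv_at i (\<lambda>v. 1) u"
    by (rule pderiv_at_cong[OF open_U assms]) (auto simp: on_sphere intro!: diff_at[OF _ assms] smooth_intros)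
  then show ?thesis using diff_at[OF smooth_x assms] by (simp add: pderiv_at_inner inner_commute)
qed

lemma inner_zero_pderiv:
  assumes "u \<in> U" "smooth_on U v" "smooth_on U w" "\<And>u. u \<in> U \<Longrightarrow> v u \<bullet> w u = 0"
  shows "v u \<bullet> pderiv_at i w u = - (pderiv_at i v u \<bullet> w u)"
proof -
  have "pderiv_at i (\<lambda>u. v u \<bullet> w u) u = pderiv_at i (\<lambda>v. 0) u"
    by (rule pderiv_at_cong[OF open_U assms(1)]) (auto simp: assms intro!: diff_at[OF _ assms(1)] smooth_intros)
  then show ?thesis using diff_at[OF assms(2,1)] diff_at[OF assms(3,1)] by (simp add: pderiv_at_inner)
qed

lemma x_inner_dde: "u \<in> U \<Longrightarrow> x u \<bullet> dd i j x u = - (e i u \<bullet> e j u)"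
  using inner_zero_pderiv[OF _ smooth_x, of u "e j" i] x_inner_e smooth_on_pderiv_at[OF smooth_x] by simp

lemma dd_commute: "u \<in> U \<Longrightarrow> smooth_on U w \<Longrightarrow> dd i j w u = dd j i w u" for w :: "real^'m \<Rightarrow> 'c::euclidean_space"
  by (rule pderiv_at_commute[OF open_U])

text \<open>In the Koszul combination of metric derivatives all terms cancel except twice the
  product of the second derivative of \<open>x\<close> with \<open>e l\<close>. Later proofs use
  Christoffel symbols in this form only.\<close>

lemma christoffel_eq:
  assumes "u \<in> U" shows "\<Gamma> k i j u = tangent_coord x u (dd i j x u) k"
proof -
  have *: "pderiv_at i (\<lambda>v. induced_metric x v $ j $ l) u = dd i j x u \<bullet> e l u + e j u \<bullet> dd i l x u" for i j l
    unfolding induced_metric_def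
    by (simp add: pderiv_at_inner diff_at[OF smooth_on_pderiv_at[OF smooth_x] assms])
  have "pderiv_at i (\<lambda>v. induced_metric x v $ j $ l) u + pderiv_at j (\<lambda>v. induced_metric x v $ i $ l) u
      - pderiv_at l (\<lambda>v. induced_metric x v $ i $ j) u = 2 * (dd i j x u \<bullet> e l u)" for l
    unfolding * dd_commute[OF assms smooth_x, of j i] dd_commute[OF assms smooth_x, of l]
    by (simp add: inner_commute)
  then show ?thesis
    by (simp add: christoffel_def tangent_coord_def sum_divide_distrib)
qed

lemma christoffel_sym: "u \<in> U \<Longrightarrow> \<Gamma> k i j u = \<Gamma> k j i u"
  using dd_commute[OF _ smooth_x] by (simp add: christoffel_eq)

lemma tangent_part_dde: "u \<in> U \<Longrightarrow> tangent_part x u (dd i j x u) = (\<Sum>k\<in>UNIV. \<Gamma> k i j u *\<^sub>R e k u)"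
  by (simp add: tangent_part_coord christoffel_eq)

section \<open>Rules for the componentwise Laplacian\<close>

lemma laplace_add:
  fixes v w :: "real^'m \<Rightarrow> 'c::euclidean_space"
  assumes "u \<in> U" "smooth_on U v" "smooth_on U w"
  shows "\<Delta> (\<lambda>u. v u + w u) u = \<Delta> v u + \<Delta> w u"
proof -
  have 1: "pderiv_at j (\<lambda>u. v u + w u) u = pderiv_at j v u + pderiv_at j w u" if "u \<in> U" for j u
    using assms that by (simp add: pderiv_at_add diff_at)
  have "dd i j (\<lambda>u. v u + w u) u = pderiv_at i (\<lambda>u. pderiv_at j v u + pderiv_at j w u) u" for i j
    by (rule pderiv_at_cong[OF open_U assms(1) 1 diff_at[OF smooth_on_pderiv_at assms(1)]])
      (assumption, intro smooth_intros assms)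
  then have "dd i j (\<lambda>u. v u + w u) u = dd i j v u + dd i j w u" for i j
    using assms by (simp add: pderiv_at_add diff_at smooth_on_pderiv_at)
  then show ?thesis unfolding laplace_beltrami_def
    by (simp add: 1 assms(1) metric_trace_add[symmetric] scaleR_add_right sum.distrib algebra_simps)
qed

lemma laplace_scaleR:
  fixes w :: "real^'m \<Rightarrow> 'c::euclidean_space"
  assumes "u \<in> U" "smooth_on U \<phi>" "smooth_on U w"
  shows "\<Delta> (\<lambda>u. \<phi> u *\<^sub>R w u) u =
    \<Delta> \<phi> u *\<^sub>R w u + \<phi> u *\<^sub>R \<Delta> w u + 2 *\<^sub>R (\<Sum>i\<in>UNIV. gradient_coord x \<phi> u i *\<^sub>R pderiv_at i w u)"
proof -
  have 1: "pderiv_at j (\<lambda>u. \<phi> u *\<^sub>R w u) u = pderiv_at j \<phi> u *\<^sub>R w u + \<phi> u *\<^sub>R pderiv_at j w u" if "u \<in> U" for j u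
    using assms that by (simp add: pderiv_at_scaleR diff_at)
  have "dd i j (\<lambda>u. \<phi> u *\<^sub>R w u) u = pderiv_at i (\<lambda>u. pderiv_at j \<phi> u *\<^sub>R w u + \<phi> u *\<^sub>R pderiv_at j w u) u" for i j
    by (rule pderiv_at_cong[OF open_U assms(1) 1 diff_at[OF smooth_on_pderiv_at assms(1)]])
      (assumption, intro smooth_intros assms)
  then have 2: "dd i j (\<lambda>u. \<phi> u *\<^sub>R w u) u = dd i j \<phi> u *\<^sub>R w u + pderiv_at j \<phi> u *\<^sub>R pderiv_at i w u
      + pderiv_at i \<phi> u *\<^sub>R pderiv_at j w u + \<phi> u *\<^sub>R dd i j w u" for i j
    using assms by (simp add: pderiv_at_add pderiv_at_scaleR diff_at smooth_intros)
  have 3: "tr u (\<lambda>i j. pderiv_at j \<phi> u *\<^sub>R pderiv_at i w u) = (\<Sum>i\<in>UNIV. gradient_coord x \<phi> u i *\<^sub>R pderiv_at i w u)"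
    by (simp add: metric_trace_def gradient_coord_def scaleR_sum_left)
  have "tr u (\<lambda>i j. pderiv_at i \<phi> u *\<^sub>R pderiv_at j w u) = tr u (\<lambda>i j. pderiv_at j \<phi> u *\<^sub>R pderiv_at i w u)"
    unfolding metric_trace_def by (subst sum.swap) (simp add: metric_inv_sym[OF assms(1)])
  note 4 = this[unfolded 3]
  have "\<Delta> (\<lambda>u. \<phi> u *\<^sub>R w u) u = tr u (\<lambda>i j. (dd i j \<phi> u - (\<Sum>k\<in>UNIV. \<Gamma> k i j u *\<^sub>R pderiv_at k \<phi> u)) *\<^sub>R w u
     + (\<phi> u *\<^sub>R (dd i j w u - (\<Sum>k\<in>UNIV. \<Gamma> k i j u *\<^sub>R pderiv_at k w u))
     + (pderiv_at j \<phi> u *\<^sub>R pderiv_at i w u + pderiv_at i \<phi> u *\<^sub>R pderiv_at j w u)))"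
    unfolding laplace_beltrami_def
    by (rule metric_trace_cong)
      (simp add: 1 2 assms(1) algebra_simps scaleR_sum_right scaleR_sum_left sum.distrib)
  also have "\<dots> = \<Delta> \<phi> u *\<^sub>R w u + \<phi> u *\<^sub>R \<Delta> w u + 2 *\<^sub>R (\<Sum>i\<in>UNIV. gradient_coord x \<phi> u i *\<^sub>R pderiv_at i w u)"
    unfolding metric_trace_add metric_trace_scaleR_left metric_trace_scaleR 3 4
    by (simp add: laplace_beltrami_def scaleR_2)
  finally show ?thesis .
qed

lemma laplace_const_scaleR:
  fixes w :: "real^'m \<Rightarrow> 'c::euclidean_space"
  assumes "u \<in> U" "smooth_on U w"
  shows "\<Delta> (\<lambda>u. c *\<^sub>R w u) u = c *\<^sub>R \<Delta> w u"
proof -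
  have "pderiv_at j (\<lambda>v::real^'m. c) = (\<lambda>v. 0)" for j by (rule ext) simp
  then have "\<Delta> (\<lambda>v::real^'m. c) u = 0" "gradient_coord x (\<lambda>v::real^'m. c) u i = 0" for i
    by (simp_all add: laplace_beltrami_def metric_trace_def gradient_coord_def)
  then show ?thesis using laplace_scaleR[OF assms(1) smooth_on_const assms(2), of c] by simp
qed

section \<open>Second fundamental form and mean curvature vector in the sphere\<close>

lemma pderiv_sphere_proj: 
  assumes "u \<in> U" "smooth_on U w" "\<And>u. u \<in> U \<Longrightarrow> w u \<bullet> x u = 0"
  shows "pderiv_at i (\<lambda>v. sphere_proj (x v) (w v)) u = pderiv_at i w u"
  by (rule pderiv_at_cong[OF open_U assms(1), symmetric]) (simp_all add: sphere_proj_def assms diff_at)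

text \<open>The Gauss formula: the multiple of \<open>x u\<close> takes away the second fundamental
  form of the sphere itself, the Christoffel sum the tangential part.\<close>

lemma second_fundamental_form_eq:
  assumes "u \<in> U"
  shows "second_fundamental_form x i j u = dd i j x u + (e i u \<bullet> e j u) *\<^sub>R x u - (\<Sum>k\<in>UNIV. \<Gamma> k i j u *\<^sub>R e k u)"
proof -
  have "sphere_proj (x u) (dd i j x u) = dd i j x u + (e i u \<bullet> e j u) *\<^sub>R x u"
    using x_inner_dde[OF assms] by (simp add: sphere_proj_def inner_commute)
  moreover have "tangent_part x u (x u) = 0" by (intro tangent_part_normal x_inner_e assms)
  ultimately show ?thesis
    using tangent_part_dde[OF assms, of i j]
    by (simp add: second_fundamental_form_def pullback_connection_def pderiv_at_def[symmetric]
      normal_part_def tangent_part_add tangent_part_scaleR)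
qed

text \<open>Trace of the Gauss formula; the trace of the metric contributes the dimension.\<close>

lemma laplace_x:
  assumes "u \<in> U"
  shows "\<Delta> x u = real CARD('m) *\<^sub>R mean_curvature_vector x u - real CARD('m) *\<^sub>R x u"
proof -
  have "real CARD('m) *\<^sub>R mean_curvature_vector x u = tr u (\<lambda>i j. second_fundamental_form x i j u)"
    by (simp add: mean_curvature_vector_def)
  also have "\<dots> = \<Delta> x u + tr u (\<lambda>i j. (e i u \<bullet> e j u) *\<^sub>R x u)"
    unfolding laplace_beltrami_def metric_trace_add[symmetric]
    by (rule metric_trace_cong) (simp add: second_fundamental_form_eq[OF assms])
  finally show ?thesis using tr_metric[OF assms] by (simp add: metric_trace_scaleR_left)
qed

lemma second_fundamental_form_normal:
  assumes "u \<in> U"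
  shows "second_fundamental_form x i j u \<bullet> e k u = 0" "second_fundamental_form x i j u \<bullet> x u = 0"
proof -
  have "second_fundamental_form x i j u = sphere_proj (x u) (dd i j x u) - tangent_part x u (sphere_proj (x u) (dd i j x u))"
    by (simp add: second_fundamental_form_def pullback_connection_def pderiv_at_def[symmetric] normal_part_def)
  then show "second_fundamental_form x i j u \<bullet> e k u = 0"
    using tangent_part_inner_e[OF assms] by (simp add: inner_diff_left)
  show "second_fundamental_form x i j u \<bullet> x u = 0"
    unfolding second_fundamental_form_eq[OF assms]
    using x_inner_e[OF assms] x_inner_dde[OF assms] on_sphere[OF assms]
    by (simp add: inner_simps inner_sum_left inner_sum_right inner_commute)
qed

lemma mean_curvature_vector_normal:
  assumes "u \<in> U"
  shows "mean_curvature_vector x u \<bullet> e k u = 0" "mean_curvature_vector x u \<bullet> x u = 0"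
  using second_fundamental_form_normal[OF assms]
  by (simp_all add: mean_curvature_vector_def metric_trace_inner, simp_all add: metric_trace_def)

lemma smooth_mean_curvature_vector: "smooth_on U (mean_curvature_vector x)"
proof (rule smooth_on_cong[OF open_U])
  show "smooth_on U (\<lambda>u. (1 / real CARD('m)) *\<^sub>R tr u (\<lambda>i j. dd i j x u + (e i u \<bullet> e j u) *\<^sub>R x u
      - (\<Sum>k\<in>UNIV. tangent_coord x u (dd i j x u) k *\<^sub>R e k u)))"
    by (intro smooth_intros smooth_metric_trace smooth_tangent_coord)
qed (simp add: mean_curvature_vector_def second_fundamental_form_eq christoffel_eq)

lemma laplace_cong:
  fixes v w :: "real^'m \<Rightarrow> 'c::euclidean_space"
  assumes "u \<in> U" "smooth_on U v" "\<And>u. u \<in> U \<Longrightarrow> v u = w u"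
  shows "\<Delta> v u = \<Delta> w u"
proof -
  have 1: "pderiv_at j v u = pderiv_at j w u" if "u \<in> U" for j u
    by (rule pderiv_at_cong[OF open_U that assms(3) diff_at[OF assms(2) that]])
  have "dd i j v u = dd i j w u" for i j
    by (rule pderiv_at_cong[OF open_U assms(1) 1 diff_at[OF smooth_on_pderiv_at[OF assms(2)] assms(1)]])
  then show ?thesis by (simp add: laplace_beltrami_def 1[OF assms(1)])
qed

section \<open>Tangential vectors and gradients\<close>

lemma tangent_inner:
  assumes "u \<in> U" "tangent_part x u t = t" shows "t \<bullet> w = t \<bullet> tangent_part x u w"
proof -
  have "t \<bullet> w = (\<Sum>i\<in>UNIV. tangent_coord x u t i *\<^sub>R e i u) \<bullet> w"
    by (simp add: tangent_part_coord[OF assms(1), symmetric] assms(2))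
  also have "\<dots> = (\<Sum>i\<in>UNIV. tangent_coord x u t i *\<^sub>R e i u) \<bullet> tangent_part x u w"
    using tangent_part_inner_e[OF assms(1), of w] by (simp add: inner_sum_left inner_commute[of "e _ u"])
  also have "\<dots> = t \<bullet> tangent_part x u w"
    by (simp add: tangent_part_coord[OF assms(1), of t, symmetric] assms(2))
  finally show ?thesis .
qed

lemma tangent_part_e: "u \<in> U \<Longrightarrow> tangent_part x u (e i u) = e i u"
  using tangent_part_sum[of u "\<lambda>k. if k = i then 1 else 0"] by (simp add: if_distrib[of "\<lambda>c. c *\<^sub>R _"] cong: if_cong)

definition grad where "grad \<phi> u = (\<Sum>i\<in>UNIV. gradient_coord x \<phi> u i *\<^sub>R e i u)"

lemma grad_inner_e: 
  assumes "u \<in> U" shows "grad \<phi> u \<bullet> e k u = pderiv_at k \<phi> u"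
proof -
  have "grad \<phi> u \<bullet> e k u = (\<Sum>j\<in>UNIV. pderiv_at j \<phi> u * (\<Sum>i\<in>UNIV. metric_inv x u $ j $ i * (e i u \<bullet> e k u)))"
    unfolding grad_def gradient_coord_def inner_sum_left inner_scaleR_left sum_distrib_left sum_distrib_right
    by (subst sum.swap) (simp add: metric_inv_sym[OF assms] algebra_simps)
  also have "\<dots> = pderiv_at k \<phi> u"
    by (simp add: metric_inv_delta[OF assms] if_distrib cong: if_cong)
  finally show ?thesis .
qed

lemma smooth_grad: "smooth_on U \<phi> \<Longrightarrow> smooth_on U (grad \<phi>)"
  unfolding grad_def[abs_def] by (intro smooth_intros smooth_gradient_coord)

lemma tangent_grad: "u \<in> U \<Longrightarrow> tangent_part x u (grad \<phi> u) = grad \<phi> u"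
  unfolding grad_def by (rule tangent_part_sum)

lemma grad_grad: "u \<in> U \<Longrightarrow> grad \<phi> u \<bullet> grad \<psi> u = (\<Sum>i\<in>UNIV. gradient_coord x \<psi> u i * pderiv_at i \<phi> u)"
  by (subst (2) grad_def) (simp add: inner_sum_right grad_inner_e)

lemma grad_x: "u \<in> U \<Longrightarrow> grad \<phi> u \<bullet> x u = 0"
  using x_inner_e by (simp add: grad_def inner_sum_left inner_commute[of _ "x u"] inner_sum_right)

end

section \<open>Biharmonic submanifolds with parallel normalized mean curvature vector field\<close>

locale pnmc_biharmonic_patch = patch U x
  for U :: "(real^'m::finite) set" and x :: "real^'m \<Rightarrow> 'a::euclidean_space" +
  fixes m :: real
  assumes m_def: "m = real CARD('m)"
    and mean_curvature_pos: "\<And>u. u \<in> U \<Longrightarrow> mean_curvature x u > 0"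
    and parallel: "\<And>u h. u \<in> U \<Longrightarrow>
      normal_connection x h (\<lambda>v. mean_curvature_vector x v /\<^sub>R mean_curvature x v) u = 0"
    and biharm: "\<And>u. u \<in> U \<Longrightarrow> rough_laplacian x (mean_curvature_vector x) u
      + metric_trace x u (\<lambda>i j. sphere_curvature (x u)
          (pderiv_at i x u) (mean_curvature_vector x u) (pderiv_at j x u)) = 0"
begin

abbreviation H where "H \<equiv> mean_curvature_vector x"
abbreviation f where "f \<equiv> mean_curvature x"

section \<open>The unit normal field and its first derivatives\<close>

definition \<xi> where "\<xi> u = H u /\<^sub>R f u"

lemma H_eq: "u \<in> U \<Longrightarrow> H u = f u *\<^sub>R \<xi> u"
  using mean_curvature_pos by (simp add: \<xi>_def less_imp_neq[symmetric])

lemma smooth_f: "smooth_on U f"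
proof -
  have "H u \<bullet> H u > 0" if "u \<in> U" for u
    using mean_curvature_pos[OF that] by (simp add: mean_curvature_def)
  then have "smooth_on U (\<lambda>u. sqrt (H u \<bullet> H u))"
    by (intro smooth_on_sqrt[OF open_U] smooth_intros smooth_mean_curvature_vector)
  then show ?thesis
    by (rule smooth_on_cong[OF open_U]) (simp add: mean_curvature_def norm_eq_sqrt_inner)
qed

lemma smooth_xi: "smooth_on U \<xi>"
proof -
  have "smooth_on U (\<lambda>u. (1 / f u) *\<^sub>R H u)"
    using mean_curvature_pos
    by (intro smooth_intros smooth_mean_curvature_vector smooth_on_divide[OF open_U] smooth_f) (simp add: less_imp_neq[symmetric])
  then show ?thesis by (rule smooth_on_cong[OF open_U]) (simp add: \<xi>_def divide_inverse)
qed

lemma xi_xi: "u \<in> U \<Longrightarrow> \<xi> u \<bullet> \<xi> u = 1"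
  using mean_curvature_pos[of u] by (simp add: \<xi>_def mean_curvature_def dot_square_norm power2_eq_square)

lemma xi_e: "u \<in> U \<Longrightarrow> \<xi> u \<bullet> e i u = 0"
  by (simp add: \<xi>_def mean_curvature_vector_normal)

lemma xi_x: "u \<in> U \<Longrightarrow> \<xi> u \<bullet> x u = 0"
  by (simp add: \<xi>_def mean_curvature_vector_normal)

lemma tangent_part_xi: "u \<in> U \<Longrightarrow> tangent_part x u (\<xi> u) = 0"
  by (intro tangent_part_normal xi_e)

lemma pderiv_xi_x: "u \<in> U \<Longrightarrow> pderiv_at i \<xi> u \<bullet> x u = 0"
  using inner_zero_pderiv[OF _ smooth_xi smooth_x, of u i] xi_x xi_e by simp

lemma pderiv_xi_xi: assumes "u \<in> U" shows "pderiv_at i \<xi> u \<bullet> \<xi> u = 0"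
proof -
  have "pderiv_at i (\<lambda>v. \<xi> v \<bullet> \<xi> v) u = pderiv_at i (\<lambda>v. 1) u"
    by (rule pderiv_at_cong[OF open_U assms xi_xi]) (auto intro!: diff_at[OF _ assms] smooth_intros smooth_xi)
  then show ?thesis using diff_at[OF smooth_xi assms] by (simp add: pderiv_at_inner inner_commute)
qed

lemma pullback_connection_xi: 
  assumes "u \<in> U" shows "pullback_connection x h \<xi> u = frechet_derivative \<xi> (at u) h"
  using pderiv_xi_x[OF assms] frechet_derivative_expand[OF diff_at[OF smooth_xi assms], of h]
  by (simp add: pullback_connection_def sphere_proj_def inner_sum_left)

text \<open>As \<xi> is orthogonal to the tangent frame, its derivative has no \<open>x\<close>
  component, and \<open>parallel\<close> removes the rest of the normal part. Hence the derivative
  of \<xi> is minus its Weingarten operator.\<close>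

lemma tangent_pderiv_xi: "u \<in> U \<Longrightarrow> tangent_part x u (pderiv_at i \<xi> u) = pderiv_at i \<xi> u"
  using parallel[of u "axis i 1"] pullback_connection_xi[of u "axis i 1"]
  by (simp add: normal_connection_def normal_part_def pderiv_at_def[symmetric] \<xi>_def[abs_def, symmetric])

lemma pderiv_xi_e: "u \<in> U \<Longrightarrow> pderiv_at i \<xi> u \<bullet> e j u = - (\<xi> u \<bullet> dd i j x u)"
  using inner_zero_pderiv[OF _ smooth_xi smooth_on_pderiv_at[OF smooth_x], of u j i] xi_e by simp

lemma pderiv_xi_sym: "u \<in> U \<Longrightarrow> pderiv_at i \<xi> u \<bullet> e j u = pderiv_at j \<xi> u \<bullet> e i u"
  using dd_commute[OF _ smooth_x, of u i j] by (simp add: pderiv_xi_e)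

section \<open>Components of the biharmonic equation\<close>

lemma laplace_x_xi: "u \<in> U \<Longrightarrow> \<Delta> x u = (m * f u) *\<^sub>R \<xi> u - m *\<^sub>R x u"
  by (simp add: laplace_x H_eq m_def)

text \<open>The componentwise Laplacian differs from minus the rough one only in the direction of
  \<open>x\<close>, and constant curvature 1 makes the curvature trace equal to -m
  \<open>H\<close>.\<close>

lemma laplace_H:
  assumes "u \<in> U" "w \<bullet> x u = 0"
  shows "\<Delta> H u \<bullet> w = - m * f u * (\<xi> u \<bullet> w)"
proof -
  note sH = smooth_mean_curvature_vector
  \<comment> \<open>Orthogonality of \<open>H\<close> to the frame makes its first derivatives
    tangent to the sphere, so the inner projection in the Hessian does nothing; the outer one
    disappears when paired with \<open>w\<close>.\<close>
  have Hx: "pderiv_at j H v \<bullet> x v = 0" if "v \<in> U" for j v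
    using inner_zero_pderiv[OF that sH smooth_x, of j] mean_curvature_vector_normal that by simp
  have pc: "pullback_connection x (axis j 1) H = (\<lambda>v. sphere_proj (x v) (pderiv_at j H v))" for j
    by (simp add: fun_eq_iff pullback_connection_def pderiv_at_def)
  have w: "sphere_proj (x u) v \<bullet> w = v \<bullet> w" for v
    using assms(2) by (simp add: sphere_proj_def inner_diff_left inner_commute[of w])
  have "hessian x H i j u \<bullet> w = dd i j H u \<bullet> w - (\<Sum>k\<in>UNIV. \<Gamma> k i j u *\<^sub>R pderiv_at k H u) \<bullet> w" for i j
    unfolding hessian_def pc
    using pderiv_sphere_proj[OF assms(1) smooth_on_pderiv_at[OF sH] Hx, of i j]
    by (simp add: pullback_connection_def pderiv_at_def[symmetric] w inner_diff_left inner_sum_left)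
  then have 1: "rough_laplacian x H u \<bullet> w = - (\<Delta> H u \<bullet> w)"
    by (simp add: rough_laplacian_def laplace_beltrami_def metric_trace_inner inner_diff_left)
  have "sphere_curvature (x u) (e i u) (H u) (e j u) = - ((e i u \<bullet> e j u) *\<^sub>R H u)" for i j
    using on_sphere[OF assms(1)] x_inner_e[OF assms(1)] mean_curvature_vector_normal[OF assms(1)]
    by (subst sphere_curvature_eq) (auto simp: inner_commute norm_eq_sqrt_inner)
  then have 2: "metric_trace x u (\<lambda>i j. sphere_curvature (x u) (e i u) (H u) (e j u)) = - (m *\<^sub>R H u)"
    by (simp add: metric_trace_uminus metric_trace_scaleR_left tr_metric[OF assms(1)] m_def)
  have "rough_laplacian x H u \<bullet> w + (- (m *\<^sub>R H u)) \<bullet> w = 0"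
    using biharm[OF assms(1)] unfolding 2 by (metis inner_add_left inner_zero_left)
  then show ?thesis unfolding 1 by (simp add: H_eq[OF assms(1)])
qed

lemma laplace_H_xi:
  assumes "u \<in> U"
  shows "\<Delta> H u = \<Delta> f u *\<^sub>R \<xi> u + f u *\<^sub>R \<Delta> \<xi> u + 2 *\<^sub>R (\<Sum>i\<in>UNIV. gradient_coord x f u i *\<^sub>R pderiv_at i \<xi> u)"
  using laplace_cong[OF assms smooth_mean_curvature_vector H_eq] laplace_scaleR[OF assms smooth_f smooth_xi]
  by simp

lemma laplace_f: "u \<in> U \<Longrightarrow> \<Delta> f u + f u * (\<Delta> \<xi> u \<bullet> \<xi> u) = - m * f u"
  using laplace_H[of u "\<xi> u"] pderiv_xi_xi
  by (simp add: laplace_H_xi inner_add_left inner_sum_left xi_xi xi_x)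

text \<open>In such a direction both \<xi> and its tangential first derivatives drop out of the
  product rule for \<open>H\<close>, so only the Laplacian of \<xi> is left.\<close>

lemma laplace_xi_normal:
  assumes "u \<in> U" "w \<bullet> x u = 0" "w \<bullet> \<xi> u = 0" "\<And>i. w \<bullet> e i u = 0"
  shows "\<Delta> \<xi> u \<bullet> w = 0"
proof -
  have "pderiv_at i \<xi> u \<bullet> w = 0" for i
    using tangent_inner[OF assms(1) tangent_pderiv_xi[OF assms(1)], of i w] tangent_part_normal[of w u] assms(4) by simp
  then have "f u * (\<Delta> \<xi> u \<bullet> w) = 0"
    using laplace_H[OF assms(1,2)] assms(3)
    by (simp add: laplace_H_xi[OF assms(1)] inner_add_left inner_sum_left inner_commute[of w])
  then show ?thesis using mean_curvature_pos[OF assms(1)] by simp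
qed

lemma trace_pderiv_xi:
  assumes "u \<in> U" shows "tr u (\<lambda>i j. pderiv_at i \<xi> u \<bullet> e j u) = - m * f u"
proof -
  have "tr u (\<lambda>i j. pderiv_at i \<xi> u \<bullet> e j u) = tr u (\<lambda>i j. - ((dd i j x u - (\<Sum>k\<in>UNIV. \<Gamma> k i j u *\<^sub>R e k u)) \<bullet> \<xi> u))"
    using xi_e[OF assms]
    by (intro metric_trace_cong)
      (simp add: pderiv_xi_e[OF assms] inner_diff_left inner_sum_left inner_commute[of "\<xi> u"])
  also have "\<dots> = - (\<Delta> x u \<bullet> \<xi> u)"
    by (simp add: metric_trace_uminus laplace_beltrami_def metric_trace_inner)
  finally show ?thesis using xi_xi[OF assms] xi_x[OF assms]
    by (simp add: laplace_x_xi[OF assms] inner_diff_left inner_commute[of "x u"])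
qed

text \<open>The trace of the Codazzi equation.  Taking the trace of the Weingarten operator as the
  trace of its matrix avoids differentiating the inverse metric.\<close>
lemma laplace_xi_e:
  assumes u: "u \<in> U" shows "\<Delta> \<xi> u \<bullet> e k u = - m * pderiv_at k f u"
proof -
  \<comment> \<open>The matrix of minus the Weingarten operator of \<xi> in the coordinate frame;
    its trace is -m \<open>f\<close>.\<close>
  define a where "a p i v = tangent_coord x v (pderiv_at i \<xi> v) p" for p i v
  have sa: "smooth_on U (a p i)" for p i
    unfolding a_def[abs_def] by (intro smooth_tangent_coord smooth_intros smooth_xi)
  have xi_i: "pderiv_at i \<xi> v = (\<Sum>p\<in>UNIV. a p i v *\<^sub>R e p v)" if "v \<in> U" for i v
    using tangent_pderiv_xi[OF that] by (simp add: a_def tangent_part_coord[OF that, symmetric])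
  have sxi: "smooth_on U (pderiv_at i \<xi>)" for i by (intro smooth_intros smooth_xi)
  have "dd k i \<xi> u = pderiv_at k (\<lambda>v. \<Sum>p\<in>UNIV. a p i v *\<^sub>R e p v) u" for i
    by (rule pderiv_at_cong[OF open_U u xi_i diff_at[OF sxi u]])
  then have dd_xi: "dd k i \<xi> u = (\<Sum>p\<in>UNIV. pderiv_at k (a p i) u *\<^sub>R e p u) + (\<Sum>p\<in>UNIV. a p i u *\<^sub>R dd k p x u)" for i
    by (simp add: pderiv_at_sum pderiv_at_scaleR diff_at[OF _ u] smooth_intros sa sum.distrib)
  have tra: "(\<Sum>i\<in>UNIV. a i i v) = - m * f v" if "v \<in> U" for v
    using trace_pderiv_xi[OF that] by (simp add: tr_inner_e[OF that] a_def)
  have "pderiv_at k (\<lambda>v. \<Sum>i\<in>UNIV. a i i v) u = pderiv_at k (\<lambda>v. - m * f v) u"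
    by (rule pderiv_at_cong[OF open_U u tra]) (auto intro!: diff_at[OF _ u] smooth_intros sa)
  then have dtra: "(\<Sum>i\<in>UNIV. pderiv_at k (a i i) u) = - m * pderiv_at k f u"
    by (simp add: pderiv_at_sum pderiv_at_mult pderiv_at_minus diff_at[OF _ u] smooth_intros sa smooth_f)
  have "tangent_coord x u (dd k i \<xi> u) i = pderiv_at k (a i i) u + (\<Sum>p\<in>UNIV. a p i u * \<Gamma> i k p u)" for i
    unfolding dd_xi tangent_coord_add tangent_coord_sum[OF u]
    by (simp add: tangent_coord_sum_left tangent_coord_scaleR christoffel_eq[OF u])
  then have 1: "tr u (\<lambda>i j. dd k i \<xi> u \<bullet> e j u) = - m * pderiv_at k f u + (\<Sum>i\<in>UNIV. \<Sum>p\<in>UNIV. a p i u * \<Gamma> i k p u)"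
    by (simp add: tr_inner_e[OF u] sum.distrib dtra)
  \<comment> \<open>The Codazzi equation in coordinates: the derivative of the symmetry of the
    Weingarten form, combined with the commuting second derivatives of \<xi>.\<close>
  have sym: "dd i j \<xi> u \<bullet> e k u = dd k i \<xi> u \<bullet> e j u + pderiv_at k \<xi> u \<bullet> dd i j x u - pderiv_at j \<xi> u \<bullet> dd i k x u" for i j
  proof -
    have "pderiv_at i (\<lambda>v. pderiv_at k \<xi> v \<bullet> e j v) u = pderiv_at i (\<lambda>v. pderiv_at j \<xi> v \<bullet> e k v) u"
      by (rule pderiv_at_cong[OF open_U u]) (auto intro!: diff_at[OF _ u] smooth_intros smooth_xi simp: pderiv_xi_sym)
    then show ?thesis
      using dd_commute[OF u smooth_xi, of i k]
      by (simp add: pderiv_at_inner diff_at[OF _ u] sxi smooth_intros)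
  qed
  have tan: "pderiv_at j \<xi> u \<bullet> dd i l x u = (\<Sum>q\<in>UNIV. \<Gamma> q i l u *\<^sub>R pderiv_at q \<xi> u) \<bullet> e j u" for i j l
    using tangent_inner[OF u tangent_pderiv_xi[OF u], of j "dd i l x u"] pderiv_xi_sym[OF u, of j]
    by (simp add: tangent_part_dde[OF u] inner_sum_right inner_sum_left)
  have "\<Delta> \<xi> u \<bullet> e k u = tr u (\<lambda>i j. dd k i \<xi> u \<bullet> e j u - (\<Sum>q\<in>UNIV. \<Gamma> q i k u *\<^sub>R pderiv_at q \<xi> u) \<bullet> e j u)"
    unfolding laplace_beltrami_def metric_trace_inner
    by (rule metric_trace_cong) (simp add: inner_diff_left sym tan)
  also have "\<dots> = - m * pderiv_at k f u + (\<Sum>i\<in>UNIV. \<Sum>p\<in>UNIV. a p i u * \<Gamma> i k p u) - (\<Sum>i\<in>UNIV. \<Sum>q\<in>UNIV. \<Gamma> q i k u * a i q u)"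
    unfolding metric_trace_diff 1 tr_inner_e[OF u]
    by (simp add: tangent_coord_sum_left tangent_coord_scaleR a_def)
  also have "(\<Sum>i\<in>UNIV. \<Sum>q\<in>UNIV. \<Gamma> q i k u * a i q u) = (\<Sum>i\<in>UNIV. \<Sum>p\<in>UNIV. a p i u * \<Gamma> i k p u)"
    by (subst sum.swap) (simp add: christoffel_sym[OF u, of _ _ k] mult.commute)
  finally show ?thesis by simp
qed

text \<open>Paired with \<open>e k\<close>, the product rule for \<open>H\<close> leaves
  \<open>f\<close> times the traced Codazzi identity plus twice the left-hand side. The 2 of the
  cross term is the origin of m / 2.\<close>

lemma weingarten_grad:
  assumes u: "u \<in> U"
  shows "(\<Sum>i\<in>UNIV. gradient_coord x f u i *\<^sub>R pderiv_at i \<xi> u) = (m / 2 * f u) *\<^sub>R grad f u" (is "?L = ?R")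
proof -
  have "(?L - ?R) \<bullet> e k u = 0" for k
  proof -
    have "f u * (\<Delta> \<xi> u \<bullet> e k u) + 2 * (?L \<bullet> e k u) = 0"
      using laplace_H[OF u, of "e k u"] x_inner_e[OF u] xi_e[OF u]
      by (simp add: laplace_H_xi[OF u] inner_add_left inner_commute[of "x u"])
    then show ?thesis by (simp add: laplace_xi_e[OF u] grad_inner_e[OF u] inner_diff_left algebra_simps)
  qed
  then have "tangent_part x u (?L - ?R) = 0" by (rule tangent_part_normal)
  moreover have "tangent_part x u ?L = ?L"
    by (simp add: tangent_part_sum_left tangent_part_scaleR tangent_pderiv_xi[OF u])
  moreover have "tangent_part x u (?L + (-1) *\<^sub>R ?R) = tangent_part x u ?L + (-1) *\<^sub>R tangent_part x u ?R"
    by (simp only: tangent_part_add tangent_part_scaleR)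
  ultimately show ?thesis by (simp add: tangent_part_scaleR tangent_grad[OF u])
qed

section \<open>The Weingarten operators of \<open>H\<close> and of \<xi>\<close>

lemma pderiv_H:
  assumes "u \<in> U" shows "pderiv_at i H u = pderiv_at i f u *\<^sub>R \<xi> u + f u *\<^sub>R pderiv_at i \<xi> u"
proof -
  have "pderiv_at i H u = pderiv_at i (\<lambda>v. f v *\<^sub>R \<xi> v) u"
    by (rule pderiv_at_cong[OF open_U assms H_eq diff_at[OF smooth_mean_curvature_vector assms]])
  then show ?thesis
    by (simp add: pderiv_at_scaleR diff_at[OF smooth_f assms] diff_at[OF smooth_xi assms])
qed

lemma pullback_connection_H:
  assumes "u \<in> U"
  shows "pullback_connection x h H u = (\<Sum>i\<in>UNIV. (h $ i * pderiv_at i f u) *\<^sub>R \<xi> u) + f u *\<^sub>R (\<Sum>i\<in>UNIV. h $ i *\<^sub>R pderiv_at i \<xi> u)"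
proof -
  have "frechet_derivative H (at u) h = (\<Sum>i\<in>UNIV. (h $ i * pderiv_at i f u) *\<^sub>R \<xi> u) + f u *\<^sub>R (\<Sum>i\<in>UNIV. h $ i *\<^sub>R pderiv_at i \<xi> u)"
    unfolding frechet_derivative_expand[OF diff_at[OF smooth_mean_curvature_vector assms]]
    by (simp add: pderiv_H[OF assms] scaleR_add_right sum.distrib scaleR_sum_right algebra_simps)
  then show ?thesis
    using xi_x[OF assms] pderiv_xi_x[OF assms]
    by (simp add: pullback_connection_def sphere_proj_def inner_add_left inner_sum_left)
qed

lemma tangent_part_pderiv_sum:
  "u \<in> U \<Longrightarrow> tangent_part x u (\<Sum>i\<in>UNIV. h i *\<^sub>R pderiv_at i \<xi> u) = (\<Sum>i\<in>UNIV. h i *\<^sub>R pderiv_at i \<xi> u)"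
  by (simp add: tangent_part_sum_left tangent_part_scaleR tangent_pderiv_xi)

lemma weingarten_H:
  assumes "u \<in> U"
  shows "weingarten x H u h = - (f u *\<^sub>R (\<Sum>i\<in>UNIV. h $ i *\<^sub>R pderiv_at i \<xi> u))"
  unfolding weingarten_def pullback_connection_H[OF assms] tangent_part_add tangent_part_sum_left[of x u "\<lambda>i. _ i *\<^sub>R \<xi> u"]
  by (simp add: tangent_part_scaleR tangent_part_xi[OF assms] tangent_part_pderiv_sum[OF assms])

lemma normal_connection_H:
  assumes "u \<in> U" "\<And>i. pderiv_at i f u = 0"
  shows "normal_connection x h H u = 0"
  using assms tangent_part_pderiv_sum[OF assms(1)]
  by (simp add: normal_connection_def normal_part_def pullback_connection_H tangent_part_scaleR)

text \<open>The Weingarten operator of \<xi>, extended by zero to vectors orthogonal to the tangent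
  space, so that the linear algebra of the ambient space applies.\<close>

definition shape where "shape u w = - (\<Sum>j\<in>UNIV. tangent_coord x u w j *\<^sub>R pderiv_at j \<xi> u)"

lemma linear_shape: "linear (shape u)"
  by (rule linearI)
    (simp_all add: shape_def tangent_coord_add tangent_coord_scaleR scaleR_add_left sum.distrib scaleR_sum_right)

lemma shape_e: assumes "u \<in> U" shows "shape u (e i u) = - pderiv_at i \<xi> u"
proof -
  have "tangent_coord x u (e i u) j = (if i = j then 1 else 0)" for j
    using metric_inv_delta[OF assms, of j i] by (simp add: tangent_coord_def inner_commute)
  then show ?thesis by (simp add: shape_def if_distrib[of "\<lambda>c. c *\<^sub>R _"] cong: if_cong)
qed

lemma tangent_shape: "u \<in> U \<Longrightarrow> tangent_part x u (shape u w) = shape u w"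
  using tangent_part_pderiv_sum[of u "\<lambda>j. - tangent_coord x u w j"]
  by (simp add: shape_def sum_negf)

lemma shape_sym:
  assumes "u \<in> U" "tangent_part x u v = v" "tangent_part x u w = w"
  shows "shape u v \<bullet> w = v \<bullet> shape u w"
proof -
  have *: "shape u v \<bullet> w = - (\<Sum>j\<in>UNIV. \<Sum>k\<in>UNIV. tangent_coord x u v j * tangent_coord x u w k * (pderiv_at j \<xi> u \<bullet> e k u))"
    if "tangent_part x u w = w" for v w
  proof -
    have "t \<bullet> w = (\<Sum>k\<in>UNIV. tangent_coord x u w k * (t \<bullet> e k u))" for t
    proof -
      have "t \<bullet> w = t \<bullet> (\<Sum>k\<in>UNIV. tangent_coord x u w k *\<^sub>R e k u)"
        by (simp add: tangent_part_coord[OF assms(1), symmetric] that)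
      then show ?thesis by (simp add: inner_sum_right)
    qed
    note this[of "pderiv_at _ \<xi> u"]
    then show ?thesis
      by (simp add: shape_def inner_sum_left sum_distrib_left mult.assoc)
  qed
  have "v \<bullet> shape u w = shape u w \<bullet> v" by (rule inner_commute)
  also have "\<dots> = shape u v \<bullet> w"
    unfolding *[OF assms(2)] *[OF assms(3)]
    by (subst sum.swap) (simp add: pderiv_xi_sym[OF assms(1)] mult.commute mult.left_commute)
  finally show ?thesis by simp
qed

text \<open>The Weingarten operator of \<open>H\<close> is \<open>f\<close> times that of \<xi>, so
  the bound on the number of eigenvalues passes from one to the other.\<close>

lemma shape_eigenvalue:
  assumes "u \<in> U" "tangent_part x u w = w" "w \<noteq> 0" "shape u w = c *\<^sub>R w"
  shows "f u * c \<in> weingarten_eigenvalues x H u"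
proof -
  define h :: "real^'m" where "h = (\<chi> i. tangent_coord x u w i)"
  have dxh: "frechet_derivative x (at u) h = w"
    unfolding dx_expand[OF assms(1)] h_def using assms(2) by (simp add: tangent_part_coord[OF assms(1), symmetric])
  then have "h \<noteq> 0" using assms(3) linear_0[OF linear_frechet_derivative[OF diff_at[OF smooth_x assms(1)]]] by auto
  moreover have "weingarten x H u h = (f u * c) *\<^sub>R w"
    using assms(4) unfolding weingarten_H[OF assms(1)] shape_def h_def by (simp flip: scaleR_minus_right)
  ultimately show ?thesis using dxh unfolding weingarten_eigenvalues_def by auto
qed

end

section \<open>The locus where the mean curvature is not stationary\<close>

text \<open>The system of ordinary differential equations satisfied along the gradient curves of \<open>f\<close>, where
  \<open>s\<close> is the squared norm of the gradient, \<open>r\<close> its derivative with respect to \<open>f\<close>, and \<open>l\<close> the Laplacian.\<close>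
lemma no_solution:
  fixes m f s r p l c d :: real
  assumes m: "m > 1" and f: "f > 0"
    and c: "c = 3 * m / (2 * (m - 1))" and d: "d = m * (m + 2) / (2 * (m - 1))"
    and rel: "r * d * f = 2 * s * (c + d - p)"
    and gauss: "p * c * s + d\<^sup>2 * f\<^sup>2 * (1 - m / 2 * c * f\<^sup>2) = 0"
    and lap: "l = - m * f + (d * m / 2 + c * m) * f ^ 3"
    and lap_s: "d * f * l + s * p = (2 * c - m) * s"
    and deriv: "c * (2 * c - m) * r = - 2 * d * (c * m + d) * f + 4 * c * d * m * (c + d) * f ^ 3"
  shows False
proof -
  \<comment> \<open>Multiplication by \<open>k\<close> clears the denominators of \<open>c\<close>
    and \<open>d\<close>.\<close>
  define k where "k = m - 1"
  have k: "k > 0" using m by (simp add: k_def)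
  have ck: "c * k = 3 * m / 2" and dk: "d * k = m * (m + 2) / 2"
    using k unfolding c d k_def[symmetric] by simp_all
  have mk: "m = k + 1" by (simp add: k_def)
  \<comment> \<open>Eliminating \<open>l\<close>, \<open>s\<close> and \<open>r\<close> will leave 2
    d f^2 (A + c m B f^2) = 0. Times k^2, both constants become polynomials in \<open>m\<close> that
    are visibly positive for m > 1.\<close>
  define A where "A = (c * m + d) * (m - c) + c * m * (2 * c - m)"
  define B where "B = (c + d) * (d + c - m) - (2 * c - m) * (d / 2 + c)"
  have "A * k\<^sup>2 = (c * k * m + d * k) * (m * k - c * k) + c * k * m * (2 * (c * k) - m * k)"
    by (simp add: A_def power2_eq_square algebra_simps)
  also have "\<dots> = m\<^sup>2 * (m + 5) * k / 2"
    unfolding ck dk unfolding mk by (simp add: power2_eq_square field_simps)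
  finally have "A * k\<^sup>2 = m\<^sup>2 * (m + 5) * k / 2" .
  moreover have "m\<^sup>2 * (m + 5) * k / 2 > 0" using k m by simp
  ultimately have "A * k\<^sup>2 > 0" by simp
  then have "A > 0" using k by (simp add: zero_less_mult_iff)
  have "B * k\<^sup>2 = (c * k + d * k) * (d * k + c * k - m * k) - (2 * (c * k) - m * k) * (d * k / 2 + c * k)"
    by (simp add: B_def power2_eq_square algebra_simps)
  also have "\<dots> = m\<^sup>2 * (6 * m + 3) / 4"
    unfolding ck dk unfolding mk by (simp add: power2_eq_square field_simps)
  finally have "B * k\<^sup>2 = m\<^sup>2 * (6 * m + 3) / 4" .
  moreover have "m\<^sup>2 * (6 * m + 3) / 4 > 0" using m by simp
  ultimately have "B * k\<^sup>2 > 0" by simp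
  then have "B > 0" using k by (simp add: zero_less_mult_iff)
  have cd: "c > 0" "d > 0" using m by (simp_all add: c d)
  \<comment> \<open>The factor 2 c - m stays: it vanishes for m = 4 and is negative for m > 4.
    Multiplying the other equations by it avoids any case distinction.\<close>
  have e1: "c * (2 * c - m) * s = - d * (c * m + d) * f\<^sup>2 + c * d * m * (c + d) * f ^ 4"
  proof -
    have "c * (2 * c - m) * s = c * d * f * l + p * c * s" using arg_cong[OF lap_s, of "\<lambda>t. c * t"] by (simp add: algebra_simps)
    also have "\<dots> = c * d * f * l - d\<^sup>2 * f\<^sup>2 * (1 - m / 2 * c * f\<^sup>2)" using gauss by simp
    also have "\<dots> = - d * (c * m + d) * f\<^sup>2 + c * d * m * (c + d) * f ^ 4"
      unfolding lap by (simp add: power2_eq_square power3_eq_cube power4_eq_xxxx algebra_simps)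
    finally show ?thesis .
  qed
  have "r * d * f = 2 * ((c + d) * s) - 2 * ((2 * c - m) * s - d * f * l)"
    using rel lap_s by (simp add: algebra_simps)
  then have "c * (2 * c - m) * (r * d * f) = c * (2 * c - m) * (2 * ((c + d) * s) - 2 * ((2 * c - m) * s - d * f * l))"
    by (rule arg_cong)
  then have "d * f * (c * (2 * c - m) * r) - (2 * (d - c + m) * (c * (2 * c - m) * s) + 2 * c * (2 * c - m) * d * f * l) = 0"
    by (simp add: algebra_simps)
  moreover have "2 * d * f\<^sup>2 * (A + c * m * B * f\<^sup>2)
      = d * f * (c * (2 * c - m) * r) - (2 * (d - c + m) * (c * (2 * c - m) * s) + 2 * c * (2 * c - m) * d * f * l)"
    unfolding deriv e1 lap A_def B_def
    by (simp add: power2_eq_square power3_eq_cube power4_eq_xxxx algebra_simps)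
  ultimately have "2 * d * f\<^sup>2 * (A + c * m * B * f\<^sup>2) = 0" by simp
  moreover have "2 * d * f\<^sup>2 * (A + c * m * B * f\<^sup>2) > 0"
    using \<open>A > 0\<close> \<open>B > 0\<close> cd m f by (intro mult_pos_pos add_pos_pos) auto
  ultimately show False by linarith
qed

locale noncmc_patch = pnmc_biharmonic_patch U x m
  for U :: "(real^'m::finite) set" and x :: "real^'m \<Rightarrow> 'a::euclidean_space" and m +
  assumes two_eigenvalues: "\<And>u. u \<in> U \<Longrightarrow> finite (weingarten_eigenvalues x H u) \<and> card (weingarten_eigenvalues x H u) \<le> 2"
    and grad_nonzero: "\<And>u. u \<in> U \<Longrightarrow> grad f u \<noteq> 0"
begin

abbreviation N where "N \<equiv> grad f"

definition \<sigma> where "\<sigma> u = N u \<bullet> N u"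
definition \<nu> where "\<nu> u = - (m / 2) * f u"
text \<open>The trace of (A - \<nu>)(A - \<mu>) = 0 solved for \<mu>. The formula is smooth because
  \<nu> < 0 < \<open>f\<close>, and it needs no information on multiplicities.\<close>

definition \<mu> where "\<mu> u = (tr u (\<lambda>i j. pderiv_at i \<xi> u \<bullet> pderiv_at j \<xi> u) - \<nu> u * (m * f u)) / (m * (f u - \<nu> u))"

lemma m_pos: "m \<ge> 1"
  using m_def by (simp add: Suc_le_eq)

lemma sigma_pos: "u \<in> U \<Longrightarrow> \<sigma> u > 0"
  using grad_nonzero by (simp add: \<sigma>_def)

lemma f_minus_lambda: "u \<in> U \<Longrightarrow> m * (f u - \<nu> u) > 0"
  using m_pos mean_curvature_pos[of u] by (simp add: \<nu>_def add_pos_nonneg)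

lemma smooth_sigma: "smooth_on U \<sigma>"
  unfolding \<sigma>_def[abs_def] by (intro smooth_intros smooth_grad smooth_f)

lemma smooth_lambda: "smooth_on U \<nu>"
  unfolding \<nu>_def[abs_def] by (intro smooth_intros smooth_f)

lemma smooth_mu: "smooth_on U \<mu>"
  unfolding \<mu>_def[abs_def]
proof (rule smooth_on_divide[OF open_U])
  show "smooth_on U (\<lambda>u. tr u (\<lambda>i j. pderiv_at i \<xi> u \<bullet> pderiv_at j \<xi> u) - \<nu> u * (m * f u))"
    by (intro smooth_intros smooth_metric_trace smooth_xi smooth_lambda smooth_f)
  show "smooth_on U (\<lambda>u. m * (f u - \<nu> u))" by (intro smooth_intros smooth_lambda smooth_f)
qed (use f_minus_lambda in force)

section \<open>Spectral structure of the Weingarten operator\<close>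

lemma gradient_field: "u \<in> U \<Longrightarrow> (\<Sum>i\<in>UNIV. gradient_coord x f u i *\<^sub>R pderiv_at i \<xi> u) = - \<nu> u *\<^sub>R N u"
  by (simp add: weingarten_grad \<nu>_def)

lemma grad_inner_xi:
  assumes "u \<in> U" shows "N u \<bullet> pderiv_at k \<xi> u = - \<nu> u * pderiv_at k f u"
proof -
  have "N u \<bullet> pderiv_at k \<xi> u = (\<Sum>i\<in>UNIV. gradient_coord x f u i *\<^sub>R pderiv_at i \<xi> u) \<bullet> e k u"
    by (simp add: grad_def inner_sum_left inner_commute[of "e _ u"] pderiv_xi_sym[OF assms, of _ k])
  then show ?thesis by (simp add: gradient_field[OF assms] grad_inner_e[OF assms])
qed

text \<open>This is (A - \<nu>)(A - \<mu>) = 0 as a bilinear form: products of two derivatives of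
  \<xi> represent the square of A, and a derivative of \<xi> against the frame represents
  -A.\<close>

lemma minimal_polynomial:
  assumes u: "u \<in> U"
  shows "pderiv_at i \<xi> u \<bullet> pderiv_at j \<xi> u + (\<nu> u + \<mu> u) * (pderiv_at i \<xi> u \<bullet> e j u)
    + \<nu> u * \<mu> u * (e i u \<bullet> e j u) = 0"
proof -
  define T where "T = {w. tangent_part x u w = w}"
  have T: "subspace T"
    unfolding T_def by (rule subspaceI) (simp_all add: tangent_part_add tangent_part_scaleR tangent_part_normal)
  have N: "N u \<in> T" by (simp add: T_def tangent_grad[OF u])
  have "shape u (N u) = \<nu> u *\<^sub>R N u"
    unfolding grad_def linear_sum[OF linear_shape] linear_scale[OF linear_shape] shape_e[OF u]
    using gradient_field[OF u] by (simp add: grad_def sum_negf)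
  then have "f u * \<nu> u \<in> weingarten_eigenvalues x H u"
    using N grad_nonzero[OF u] by (intro shape_eigenvalue[OF u]) (auto simp: T_def)
  moreover define E where "E = weingarten_eigenvalues x H u - {f u * \<nu> u}"
  ultimately have "card E \<le> 1" "finite E" using two_eigenvalues[OF u] by auto
  \<comment> \<open>The candidate for the second eigenvalue of the operator of \<open>H\<close>;
    mere inclusion covers an empty \<open>E\<close> as well.\<close>
  then obtain b where b: "E \<subseteq> {b}"
    using card_le_Suc0_iff_eq by (metis One_nat_def insertCI subsetI)
  define \<beta> where "\<beta> = b / f u"
  have fu: "f u > 0" by (rule mean_curvature_pos[OF u])
  have "c = \<nu> u \<or> c = \<beta>" if "w \<in> T" "w \<noteq> 0" "shape u w = c *\<^sub>R w" for c w
  proof -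
    have "f u * c \<in> weingarten_eigenvalues x H u"
      using that by (intro shape_eigenvalue[OF u]) (auto simp: T_def)
    then have "f u * c = f u * \<nu> u \<or> f u * c = b" using b unfolding E_def by blast
    then show ?thesis using fu by (auto simp: \<beta>_def)
  qed
  note eig = this
  have "shape u (shape u v) = (\<nu> u + \<beta>) *\<^sub>R shape u v - (\<nu> u * \<beta>) *\<^sub>R v" if "v \<in> T" for v
    by (rule two_eigenvalues_quadratic[OF T linear_shape _ _ eig that])
      (auto simp: T_def tangent_shape[OF u] shape_sym[OF u])
  note quad = this
  have Q: "pderiv_at i \<xi> u \<bullet> pderiv_at j \<xi> u = - (\<nu> u + \<beta>) * (pderiv_at i \<xi> u \<bullet> e j u) - \<nu> u * \<beta> * (e i u \<bullet> e j u)" for i j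
  proof -
    have "pderiv_at i \<xi> u \<bullet> pderiv_at j \<xi> u = shape u (shape u (e i u)) \<bullet> e j u"
      using shape_sym[OF u tangent_shape[OF u] tangent_part_e[OF u], of "e i u" j] by (simp add: shape_e[OF u])
    also have "\<dots> = ((\<nu> u + \<beta>) *\<^sub>R shape u (e i u) - (\<nu> u * \<beta>) *\<^sub>R e i u) \<bullet> e j u"
      using quad[of "e i u"] by (simp add: T_def tangent_part_e[OF u])
    finally show ?thesis by (simp add: shape_e[OF u] inner_diff_left algebra_simps)
  qed
  \<comment> \<open>Taking the trace identifies the pointwise root \<beta> with the smooth function
    \<mu>.\<close>
  have "tr u (\<lambda>i j. pderiv_at i \<xi> u \<bullet> pderiv_at j \<xi> u) = - (\<nu> u + \<beta>) * (- m * f u) - \<nu> u * \<beta> * m"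
    unfolding Q metric_trace_diff metric_trace_mult trace_pderiv_xi[OF u] tr_metric[OF u] m_def by simp
  then have "\<beta> * (m * (f u - \<nu> u)) = tr u (\<lambda>i j. pderiv_at i \<xi> u \<bullet> pderiv_at j \<xi> u) - \<nu> u * (m * f u)"
    by (simp add: algebra_simps)
  then have "\<beta> = \<mu> u" using f_minus_lambda[OF u] by (metis \<mu>_def less_irrefl nonzero_eq_divide_eq)
  then show ?thesis unfolding Q by (simp add: algebra_simps)
qed

text \<open>Differentiating the eigenvector equation of a field produces derivatives of its
  coefficients, but these cancel against \<open>q\<close>, itself an eigenvector for \<nu> of a
  self-adjoint operator.\<close>

lemma kernel_field_derivative:
  assumes u: "u \<in> U" and P: "\<And>i. smooth_on U (P i)"
    and kerP: "\<And>v. v \<in> U \<Longrightarrow> (\<Sum>i\<in>UNIV. P i v *\<^sub>R pderiv_at i \<xi> v) = - \<nu> v *\<^sub>R (\<Sum>i\<in>UNIV. P i v *\<^sub>R e i v)"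
    and q: "\<And>i. pderiv_at i \<xi> u \<bullet> q = - \<nu> u * (e i u \<bullet> q)"
  shows "(\<Sum>i\<in>UNIV. P i u * ((dd j i \<xi> u + \<nu> u *\<^sub>R dd j i x u) \<bullet> q))
    = - pderiv_at j \<nu> u * ((\<Sum>i\<in>UNIV. P i u *\<^sub>R e i u) \<bullet> q)"
proof -
  let ?F = "\<lambda>v. (\<Sum>i\<in>UNIV. P i v *\<^sub>R pderiv_at i \<xi> v)" and ?G = "\<lambda>v. (\<Sum>i\<in>UNIV. P i v *\<^sub>R e i v)"
  note sm = smooth_intros P smooth_xi smooth_lambda
  have "pderiv_at j ?F u = pderiv_at j (\<lambda>v. - \<nu> v *\<^sub>R ?G v) u"
    by (rule pderiv_at_cong[OF open_U u kerP]) (assumption, intro diff_at[OF _ u] sm)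
  also have "\<dots> = - pderiv_at j \<nu> u *\<^sub>R ?G u - \<nu> u *\<^sub>R pderiv_at j ?G u"
    by (subst pderiv_at_scaleR) (simp_all add: diff_at[OF _ u] sm pderiv_at_minus)
  finally have "pderiv_at j ?F u \<bullet> q + \<nu> u * (pderiv_at j ?G u \<bullet> q) = - pderiv_at j \<nu> u * (?G u \<bullet> q)"
    by (simp add: inner_diff_left)
  moreover have "pderiv_at j ?F u \<bullet> q = (\<Sum>i\<in>UNIV. pderiv_at j (P i) u * (pderiv_at i \<xi> u \<bullet> q)) + (\<Sum>i\<in>UNIV. P i u * (dd j i \<xi> u \<bullet> q))"
    by (simp add: pderiv_at_sum pderiv_at_scaleR diff_at[OF _ u] sm inner_sum_left inner_add_left sum.distrib)
  moreover have "pderiv_at j ?G u \<bullet> q = (\<Sum>i\<in>UNIV. pderiv_at j (P i) u * (e i u \<bullet> q)) + (\<Sum>i\<in>UNIV. P i u * (dd j i x u \<bullet> q))"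
    by (simp add: pderiv_at_sum pderiv_at_scaleR diff_at[OF _ u] sm inner_sum_left inner_add_left sum.distrib)
  moreover have "(\<Sum>i\<in>UNIV. pderiv_at j (P i) u * (pderiv_at i \<xi> u \<bullet> q)) = - \<nu> u * (\<Sum>i\<in>UNIV. pderiv_at j (P i) u * (e i u \<bullet> q))"
    by (simp add: q sum_distrib_left sum_negf mult.left_commute)
  moreover have "(\<Sum>i\<in>UNIV. P i u * ((dd j i \<xi> u + \<nu> u *\<^sub>R dd j i x u) \<bullet> q))
      = (\<Sum>i\<in>UNIV. P i u * (dd j i \<xi> u \<bullet> q)) + \<nu> u * (\<Sum>i\<in>UNIV. P i u * (dd j i x u \<bullet> q))"
    by (simp add: inner_add_left distrib_left sum.distrib sum_distrib_left mult.left_commute)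
  ultimately show ?thesis by algebra
qed

text \<open>Eigenvectors of the Weingarten operator for the eigenvalue \<open>\<nu>\<close> are multiples of the gradient:
  on a Codazzi tensor, an eigenvalue of multiplicity at least two is constant along its eigenspaces,
  whereas \<open>\<nu>\<close> varies in the direction of the gradient.\<close>
lemma codazzi_kernel:
  assumes u: "u \<in> U" and Y: "\<And>i. smooth_on U (Y i)"
    and kerY: "\<And>v. v \<in> U \<Longrightarrow> (\<Sum>i\<in>UNIV. Y i v *\<^sub>R pderiv_at i \<xi> v) = - \<nu> v *\<^sub>R (\<Sum>i\<in>UNIV. Y i v *\<^sub>R e i v)"
  shows "(\<Sum>i\<in>UNIV. Y i u *\<^sub>R e i u) = ((\<Sum>i\<in>UNIV. Y i u * pderiv_at i f u) / \<sigma> u) *\<^sub>R N u"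
proof -
  define q where "q = (\<Sum>i\<in>UNIV. Y i u *\<^sub>R e i u)"
  define X where "X i v = gradient_coord x f v i" for i v
  have sX: "smooth_on U (X i)" for i unfolding X_def[abs_def] by (intro smooth_gradient_coord smooth_f)
  have NX: "N v = (\<Sum>i\<in>UNIV. X i v *\<^sub>R e i v)" for v by (simp add: grad_def X_def)
  have kerX: "(\<Sum>i\<in>UNIV. X i v *\<^sub>R pderiv_at i \<xi> v) = - \<nu> v *\<^sub>R (\<Sum>i\<in>UNIV. X i v *\<^sub>R e i v)" if "v \<in> U" for v
    using gradient_field[OF that] by (simp add: NX[symmetric]) (simp add: X_def)
  have q: "pderiv_at i \<xi> u \<bullet> q = - \<nu> u * (e i u \<bullet> q)" for i
  proof -
    have "pderiv_at i \<xi> u \<bullet> q = (\<Sum>k\<in>UNIV. Y k u *\<^sub>R pderiv_at k \<xi> u) \<bullet> e i u"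
      by (simp add: q_def inner_sum_left inner_sum_right pderiv_xi_sym[OF u, of i])
    also have "\<dots> = - \<nu> u * (q \<bullet> e i u)" by (simp add: kerY[OF u] q_def)
    finally show ?thesis by (simp add: inner_commute)
  qed
  \<comment> \<open>Symmetric in its indices because it contains only second partial derivatives;
    this symmetry plays the part of the Codazzi equation.\<close>
  define W where "W j i = (dd j i \<xi> u + \<nu> u *\<^sub>R dd j i x u) \<bullet> q" for i j
  have Wsym: "W j i = W i j" for i j
    using dd_commute[OF u smooth_xi, of i j] dd_commute[OF u smooth_x, of i j] by (simp add: W_def)
  have dl: "pderiv_at j \<nu> u = - (m / 2) * pderiv_at j f u" for j
    unfolding \<nu>_def[abs_def] by (subst pderiv_at_mult) (simp_all add: diff_at[OF _ u] smooth_intros smooth_f)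
  have 1: "(\<Sum>i\<in>UNIV. X i u * W j i) = m / 2 * pderiv_at j f u * (N u \<bullet> q)" for j
    using kernel_field_derivative[OF u sX kerX q, of j] by (simp add: W_def NX dl)
  have 2: "(\<Sum>i\<in>UNIV. Y i u * W j i) = m / 2 * pderiv_at j f u * (q \<bullet> q)" for j
    using kernel_field_derivative[OF u Y kerY q, of j] by (simp add: W_def q_def[symmetric] dl)
  \<comment> \<open>\<open>W\<close> is evaluated on the gradient and on the field \<open>Y\<close>
    in both orders. Each order differentiates \<nu> along the other field.\<close>
  have "(\<Sum>j\<in>UNIV. Y j u * (\<Sum>i\<in>UNIV. X i u * W j i)) = (\<Sum>j\<in>UNIV. X j u * (\<Sum>i\<in>UNIV. Y i u * W j i))"
    unfolding sum_distrib_left by (subst sum.swap) (simp add: Wsym[of _ ] mult.left_commute)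
  note swap = this
  have "(\<Sum>j\<in>UNIV. Y j u * pderiv_at j f u) * (N u \<bullet> q) = (\<Sum>j\<in>UNIV. X j u * pderiv_at j f u) * (q \<bullet> q)"
  proof -
    have "(\<Sum>j\<in>UNIV. Z j u * (m / 2 * pderiv_at j f u * s)) = m / 2 * ((\<Sum>j\<in>UNIV. Z j u * pderiv_at j f u) * s)" for Z s
      by (simp add: sum_distrib_left sum_distrib_right mult.assoc mult.left_commute)
    from swap[unfolded 1 2, unfolded this] show ?thesis using m_pos by simp
  qed
  moreover have Nq: "N u \<bullet> q = (\<Sum>j\<in>UNIV. Y j u * pderiv_at j f u)"
    by (simp add: q_def inner_sum_right grad_inner_e[OF u])
  moreover have "(\<Sum>j\<in>UNIV. X j u * pderiv_at j f u) = \<sigma> u"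
    by (simp add: \<sigma>_def grad_grad[OF u] X_def)
  \<comment> \<open>Equality in the Cauchy-Schwarz inequality, so \<open>q\<close> is parallel to
    the gradient.\<close>
  ultimately have CS: "(N u \<bullet> q) * (N u \<bullet> q) = \<sigma> u * (q \<bullet> q)" by simp
  define r where "r = q - ((N u \<bullet> q) / \<sigma> u) *\<^sub>R N u"
  have "r \<bullet> r = 0"
    using CS sigma_pos[OF u] by (simp add: r_def inner_diff_left inner_diff_right inner_commute \<sigma>_def[symmetric] field_simps)
  then show ?thesis unfolding Nq[symmetric] q_def[symmetric] by (simp add: r_def)
qed

text \<open>By the minimal polynomial, A - \<mu> maps the coordinate fields into the eigenspace of
  \<nu>. These images are smooth, so \<open>codazzi_kernel\<close> applies to them without the
  choice of an eigenframe.\<close>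

lemma pderiv_xi:
  assumes u: "u \<in> U"
  shows "pderiv_at k \<xi> u = - \<mu> u *\<^sub>R e k u + ((\<mu> u - \<nu> u) * pderiv_at k f u / \<sigma> u) *\<^sub>R N u"
proof -
  define t where "t v = pderiv_at k \<xi> v + \<mu> v *\<^sub>R e k v" for v
  define Y where "Y i v = tangent_coord x v (t v) i" for i v
  have st: "smooth_on U t" unfolding t_def[abs_def] by (intro smooth_intros smooth_xi smooth_mu)
  have sY: "smooth_on U (Y i)" for i unfolding Y_def[abs_def] by (intro smooth_tangent_coord st)
  have tt: "tangent_part x v (t v) = t v" if "v \<in> U" for v
    by (simp add: t_def tangent_part_add tangent_part_scaleR tangent_pderiv_xi[OF that] tangent_part_e[OF that])
  have tY: "(\<Sum>i\<in>UNIV. Y i v *\<^sub>R e i v) = t v" if "v \<in> U" for v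
    using tt[OF that] by (simp add: Y_def tangent_part_coord[OF that, symmetric])
  have kerY: "(\<Sum>i\<in>UNIV. Y i v *\<^sub>R pderiv_at i \<xi> v) = - \<nu> v *\<^sub>R (\<Sum>i\<in>UNIV. Y i v *\<^sub>R e i v)" if v: "v \<in> U" for v
  proof -
    let ?r = "(\<Sum>i\<in>UNIV. Y i v *\<^sub>R pderiv_at i \<xi> v) + \<nu> v *\<^sub>R t v"
    have "?r \<bullet> e j v = 0" for j
    proof -
      have "?r \<bullet> e j v = pderiv_at j \<xi> v \<bullet> (\<Sum>i\<in>UNIV. Y i v *\<^sub>R e i v) + \<nu> v * (t v \<bullet> e j v)"
        by (simp add: inner_add_left inner_sum_left inner_sum_right pderiv_xi_sym[OF v, of j])
      also have "\<dots> = 0" unfolding tY[OF v]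
        using minimal_polynomial[OF v, of j k] pderiv_xi_sym[OF v, of k j]
        by (simp add: t_def inner_add_left inner_add_right inner_commute[of "e k v"] algebra_simps)
      finally show ?thesis .
    qed
    then have "tangent_part x v ?r = 0" by (rule tangent_part_normal)
    then have "?r = 0" by (simp add: tangent_part_add tangent_part_scaleR tangent_part_pderiv_sum[OF v] tt[OF v])
    then show ?thesis by (simp add: tY[OF v] add_eq_0_iff)
  qed
  have "(\<Sum>i\<in>UNIV. Y i u * pderiv_at i f u) = N u \<bullet> t u"
    by (simp add: tY[OF u, symmetric] inner_sum_right grad_inner_e[OF u])
  also have "\<dots> = (\<mu> u - \<nu> u) * pderiv_at k f u"
    by (simp add: t_def inner_add_right grad_inner_xi[OF u] grad_inner_e[OF u] algebra_simps)
  finally have "t u = ((\<mu> u - \<nu> u) * pderiv_at k f u / \<sigma> u) *\<^sub>R N u"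
    using codazzi_kernel[OF u sY kerY] by (simp add: tY[OF u])
  then show ?thesis by (simp add: t_def algebra_simps)
qed

lemma mu_eq: "u \<in> U \<Longrightarrow> (m - 1) * \<mu> u = 3 / 2 * m * f u"
proof -
  assume u: "u \<in> U"
  have "- m * f u = tr u (\<lambda>i j. - \<mu> u * (e i u \<bullet> e j u) + (\<mu> u - \<nu> u) / \<sigma> u * ((N u \<bullet> e i u) * (N u \<bullet> e j u)))"
    unfolding trace_pderiv_xi[OF u, symmetric]
    by (rule metric_trace_cong) (simp add: pderiv_xi[OF u] inner_add_left inner_diff_left grad_inner_e[OF u])
  also have "\<dots> = - \<mu> u * m + (\<mu> u - \<nu> u) / \<sigma> u * \<sigma> u"
    unfolding metric_trace_add metric_trace_mult tr_metric[OF u] tr_tensor[OF u] tangent_grad[OF u]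
    by (simp add: \<sigma>_def m_def)
  also have "\<dots> = - \<mu> u * m + (\<mu> u - \<nu> u)" using sigma_pos[OF u] by simp
  finally show ?thesis by (simp add: \<nu>_def algebra_simps)
qed

section \<open>The map \<open>F\<close> as a curve parametrized by \<open>f\<close>\<close>

definition c where "c = 3 * m / (2 * (m - 1))"
text \<open>Equal to c + m / 2, so that the eigenvalue gap \<mu> - \<nu> is \<open>d\<close> times
  \<open>f\<close>.\<close>

definition d where "d = m * (m + 2) / (2 * (m - 1))"
definition \<psi> where "\<psi> u = d * f u / \<sigma> u"
definition F where "F u = \<xi> u + c *\<^sub>R (f u *\<^sub>R x u)"
definition G where "G u = c *\<^sub>R x u + \<psi> u *\<^sub>R N u"

text \<open>If \<open>W\<close> is locally a function of \<open>f\<close>, this is the derivative of \<open>W\<close> with respect to \<open>f\<close>.\<close>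
definition deriv_f where "deriv_f W u = (1 / \<sigma> u) *\<^sub>R (\<Sum>j\<in>UNIV. gradient_coord x f u j *\<^sub>R pderiv_at j W u)"

abbreviation G' where "G' \<equiv> deriv_f G"
definition p where "p u = G' u \<bullet> N u"

text \<open>For m = 1 the left-hand side of \<open>mu_eq\<close> would vanish although
  \<open>f\<close> is positive.\<close>

lemma m_gt_1: "u \<in> U \<Longrightarrow> m > 1"
  using mu_eq[of u] mean_curvature_pos[of u] m_pos by (cases "m = 1") auto

lemma mu_c: "u \<in> U \<Longrightarrow> \<mu> u = c * f u"
  using mu_eq[of u] m_gt_1[of u] by (simp add: c_def field_simps)

lemma mu_nu: "u \<in> U \<Longrightarrow> \<mu> u - \<nu> u = d * f u"
  using m_gt_1[of u] by (simp add: mu_c c_def d_def \<nu>_def field_simps)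

lemma smooth_psi: "smooth_on U \<psi>"
  unfolding \<psi>_def[abs_def] using sigma_pos
  by (intro smooth_on_divide[OF open_U] smooth_intros smooth_f smooth_sigma) (auto simp: less_imp_neq[symmetric])

lemma d_pos: "u \<in> U \<Longrightarrow> d > 0"
  using m_gt_1[of u] unfolding d_def by (intro divide_pos_pos mult_pos_pos) auto

lemma psi_pos: "u \<in> U \<Longrightarrow> \<psi> u > 0"
  using d_pos[of u] sigma_pos[of u] mean_curvature_pos[of u] by (simp add: \<psi>_def)

lemma psi_sigma: "u \<in> U \<Longrightarrow> \<psi> u * \<sigma> u = d * f u"
  using sigma_pos[of u] by (simp add: \<psi>_def)

lemma smooth_N: "smooth_on U N"
  by (rule smooth_grad[OF smooth_f])

lemma smooth_G: "smooth_on U G"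
  unfolding G_def[abs_def] by (intro smooth_intros smooth_psi smooth_N)

lemma smooth_deriv_f: "smooth_on U W \<Longrightarrow> smooth_on U (deriv_f W)"
  unfolding deriv_f_def[abs_def] using sigma_pos
  by (intro smooth_intros smooth_on_divide[OF open_U] smooth_gradient_coord smooth_f smooth_sigma)
    (auto simp: less_imp_neq[symmetric])

lemma sigma_sum: "u \<in> U \<Longrightarrow> (\<Sum>j\<in>UNIV. gradient_coord x f u j * pderiv_at j f u) = \<sigma> u"
  by (simp add: \<sigma>_def grad_grad)

text \<open>The symmetry of the second derivatives of \<open>W\<close> makes \<open>df \<otimes> dV\<close> symmetric.\<close>
lemma pderiv_deriv_f:
  fixes W V :: "real^'m \<Rightarrow> 'a"
  assumes u: "u \<in> U" and W: "smooth_on U W" and V: "smooth_on U V"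
    and WV: "\<And>v k. v \<in> U \<Longrightarrow> pderiv_at k W v = pderiv_at k f v *\<^sub>R V v"
  shows "dd i j W u = dd i j f u *\<^sub>R V u + (pderiv_at i f u * pderiv_at j f u) *\<^sub>R deriv_f V u"
    and "pderiv_at k V u = pderiv_at k f u *\<^sub>R deriv_f V u"
proof -
  have *: "dd i j W u = dd i j f u *\<^sub>R V u + pderiv_at j f u *\<^sub>R pderiv_at i V u" for i j
  proof -
    have "dd i j W u = pderiv_at i (\<lambda>v. pderiv_at j f v *\<^sub>R V v) u"
      by (rule pderiv_at_cong[OF open_U u WV diff_at[OF smooth_on_pderiv_at[OF W] u]])
    then show ?thesis by (simp add: pderiv_at_scaleR diff_at[OF _ u] smooth_intros smooth_f V)
  qed
  have **: "pderiv_at j f u *\<^sub>R pderiv_at i V u = pderiv_at i f u *\<^sub>R pderiv_at j V u" for i j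
    using *[of i j] *[of j i] dd_commute[OF u W, of i j] dd_commute[OF u smooth_f, of i j] by simp
  show 1: "pderiv_at k V u = pderiv_at k f u *\<^sub>R deriv_f V u" for k
  proof -
    have "\<sigma> u *\<^sub>R pderiv_at k V u = (\<Sum>j\<in>UNIV. gradient_coord x f u j *\<^sub>R (pderiv_at j f u *\<^sub>R pderiv_at k V u))"
      by (simp add: sigma_sum[OF u, symmetric] scaleR_sum_left)
    also have "\<dots> = \<sigma> u *\<^sub>R (pderiv_at k f u *\<^sub>R deriv_f V u)"
      unfolding **[of _ k] using sigma_pos[OF u] by (simp add: deriv_f_def scaleR_sum_right mult.commute)
    finally show ?thesis using sigma_pos[OF u] by (simp del: scaleR_scaleR)
  qed
  show "dd i j W u = dd i j f u *\<^sub>R V u + (pderiv_at i f u * pderiv_at j f u) *\<^sub>R deriv_f V u"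
    unfolding * 1 by (simp add: mult.commute)
qed

lemma smooth_F: "smooth_on U F"
  unfolding F_def[abs_def] by (intro smooth_intros smooth_xi smooth_f)

text \<open>The terms along \<open>e k\<close> cancel since \<mu> = c \<open>f\<close>; every
  remaining term carries the factor \<open>pderiv_at k f u\<close>.\<close>

lemma pderiv_F:
  assumes u: "u \<in> U"
  shows "pderiv_at k F u = pderiv_at k f u *\<^sub>R G u"
proof -
  have "pderiv_at k F u = pderiv_at k \<xi> u + c *\<^sub>R (pderiv_at k f u *\<^sub>R x u + f u *\<^sub>R e k u)"
    unfolding F_def[abs_def]
    by (simp add: pderiv_at_add pderiv_at_scaleR diff_at[OF _ u] smooth_intros smooth_f smooth_xi del: scaleR_scaleR)
  then show ?thesis
    by (simp add: pderiv_xi[OF u] mu_nu[OF u] G_def \<psi>_def) (simp add: mu_c[OF u] algebra_simps)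
qed

lemmas pderiv_G = pderiv_deriv_f(2)[OF _ smooth_F smooth_G pderiv_F]
lemmas pderiv_G' = pderiv_deriv_f(2)[OF _ smooth_G smooth_deriv_f[OF smooth_G] pderiv_G]

text \<open>The left side comes from the definition of \<open>F\<close>, the right side from the
  chain rule for a function of \<open>f\<close>. The components along \<xi>, along the gradient and
  orthogonal to all known vectors are used separately below.\<close>

lemma laplace_F:
  assumes u: "u \<in> U"
  shows "\<Delta> \<xi> u + c *\<^sub>R (\<Delta> f u *\<^sub>R x u + f u *\<^sub>R ((m * f u) *\<^sub>R \<xi> u - m *\<^sub>R x u) + 2 *\<^sub>R N u) = \<Delta> f u *\<^sub>R G u + \<sigma> u *\<^sub>R G' u"
proof -
  have "\<Delta> F u = \<Delta> \<xi> u + c *\<^sub>R \<Delta> (\<lambda>v. f v *\<^sub>R x v) u"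
    unfolding F_def[abs_def]
    by (subst laplace_add[OF u]) (simp_all add: laplace_const_scaleR[OF u] smooth_intros smooth_xi smooth_f del: scaleR_scaleR)
  also have "\<dots> = \<Delta> \<xi> u + c *\<^sub>R (\<Delta> f u *\<^sub>R x u + f u *\<^sub>R ((m * f u) *\<^sub>R \<xi> u - m *\<^sub>R x u) + 2 *\<^sub>R N u)"
    by (simp add: laplace_scaleR[OF u smooth_f smooth_x] laplace_x_xi[OF u] grad_def)
  finally have 1: "\<Delta> F u = \<dots>" .
  have "\<Delta> F u = tr u (\<lambda>i j. (dd i j f u - (\<Sum>k\<in>UNIV. \<Gamma> k i j u *\<^sub>R pderiv_at k f u)) *\<^sub>R G u + ((N u \<bullet> e i u) * (N u \<bullet> e j u)) *\<^sub>R G' u)"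
    unfolding laplace_beltrami_def
    by (rule metric_trace_cong)
      (simp add: pderiv_F[OF u] pderiv_deriv_f(1)[OF u smooth_F smooth_G pderiv_F] grad_inner_e[OF u] scaleR_diff_left scaleR_sum_left)
  also have "\<dots> = \<Delta> f u *\<^sub>R G u + \<sigma> u *\<^sub>R G' u"
    unfolding metric_trace_add metric_trace_scaleR_left tr_tensor[OF u] tangent_grad[OF u]
    by (simp add: laplace_beltrami_def \<sigma>_def)
  finally show ?thesis using 1 by simp
qed

section \<open>Derivatives of the gradient and of its squared norm\<close>

lemma pderiv_G_expand:
  assumes u: "u \<in> U"
  shows "pderiv_at k f u *\<^sub>R G' u = c *\<^sub>R e k u + pderiv_at k \<psi> u *\<^sub>R N u + \<psi> u *\<^sub>R pderiv_at k N u"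
proof -
  have "pderiv_at k G u = c *\<^sub>R e k u + pderiv_at k \<psi> u *\<^sub>R N u + \<psi> u *\<^sub>R pderiv_at k N u"
    unfolding G_def[abs_def]
    by (simp add: pderiv_at_add pderiv_at_scaleR diff_at[OF _ u] smooth_intros smooth_psi smooth_N)
  then show ?thesis by (simp only: pderiv_G[OF u])
qed

lemma pderiv_N:
  assumes u: "u \<in> U"
  shows "pderiv_at k N u \<bullet> x u = - pderiv_at k f u"
    and "pderiv_at k N u \<bullet> \<xi> u = \<nu> u * pderiv_at k f u"
    and "pderiv_at i N u \<bullet> e j u = pderiv_at j N u \<bullet> e i u"
    and "pderiv_at k N u \<bullet> N u = pderiv_at k \<sigma> u / 2"
proof -
  show "pderiv_at k N u \<bullet> x u = - pderiv_at k f u"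
    using inner_zero_pderiv[OF u smooth_N smooth_x, of k] by (simp add: grad_x grad_inner_e[OF u])
  have "N v \<bullet> \<xi> v = 0" if "v \<in> U" for v
    using xi_e[OF that] by (simp add: grad_def inner_sum_left inner_commute[of "e _ v"])
  then show "pderiv_at k N u \<bullet> \<xi> u = \<nu> u * pderiv_at k f u"
    using inner_zero_pderiv[OF u smooth_N smooth_xi, of k] by (simp add: grad_inner_xi[OF u])
  have "dd i j f u = pderiv_at i N u \<bullet> e j u + N u \<bullet> dd i j x u" for i j
  proof -
    have "dd i j f u = pderiv_at i (\<lambda>v. N v \<bullet> e j v) u"
      by (rule pderiv_at_cong[OF open_U u _ diff_at[OF smooth_on_pderiv_at[OF smooth_f] u]]) (simp add: grad_inner_e)
    then show ?thesis by (simp add: pderiv_at_inner diff_at[OF _ u] smooth_intros smooth_N)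
  qed
  from this[of i j] this[of j i] show "pderiv_at i N u \<bullet> e j u = pderiv_at j N u \<bullet> e i u"
    using dd_commute[OF u smooth_f, of i j] dd_commute[OF u smooth_x, of i j] by simp
  show "pderiv_at k N u \<bullet> N u = pderiv_at k \<sigma> u / 2"
    unfolding \<sigma>_def[abs_def] by (simp add: pderiv_at_inner diff_at[OF smooth_N u] inner_commute)
qed

lemma pderiv_psi:
  assumes u: "u \<in> U"
  shows "pderiv_at k \<psi> u * \<sigma> u + \<psi> u * pderiv_at k \<sigma> u = d * pderiv_at k f u"
proof -
  have "pderiv_at k (\<lambda>v. \<psi> v * \<sigma> v) u = pderiv_at k (\<lambda>v. d * f v) u"
    by (rule pderiv_at_cong[OF open_U u psi_sigma]) (assumption, intro diff_at[OF _ u] smooth_intros smooth_psi smooth_sigma)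
  then show ?thesis
    by (simp add: pderiv_at_mult diff_at[OF _ u] smooth_psi smooth_sigma smooth_f smooth_intros)
qed

text \<open>The component along \<open>N\<close> of dG = G' df, with the derivative of \<psi>
  eliminated through \<psi> \<sigma> = d \<open>f\<close>.\<close>

lemma pderiv_sigma:
  assumes u: "u \<in> U"
  shows "\<psi> u * pderiv_at k \<sigma> u = 2 * (c + d - p u) * pderiv_at k f u"
proof -
  have "pderiv_at k f u * p u = (pderiv_at k f u *\<^sub>R G' u) \<bullet> N u" by (simp add: p_def)
  also have "\<dots> = c * pderiv_at k f u + pderiv_at k \<psi> u * \<sigma> u + \<psi> u * pderiv_at k \<sigma> u / 2"
    unfolding pderiv_G_expand[OF u] using grad_inner_e[OF u, of f k]
    by (simp add: inner_add_left pderiv_N(4)[OF u] \<sigma>_def[symmetric] inner_commute[of "e k u"])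
  finally show ?thesis using pderiv_psi[OF u, of k] by (simp add: algebra_simps)
qed

lemma pderiv_psi_f:
  assumes u: "u \<in> U"
  obtains \<theta> where "\<And>k. pderiv_at k \<psi> u = \<theta> * pderiv_at k f u"
proof
  fix k
  have "pderiv_at k \<psi> u * \<sigma> u = (d - 2 * (c + d - p u)) * pderiv_at k f u"
    using pderiv_psi[OF u, of k] unfolding pderiv_sigma[OF u] by (simp add: algebra_simps)
  then show "pderiv_at k \<psi> u = (d - 2 * (c + d - p u)) / \<sigma> u * pderiv_at k f u"
    using sigma_pos[OF u] by (simp add: field_simps)
qed

text \<open>The \<open>x\<close>, \<xi> and tangential components are read off from dG = G' df; the
  normal biharmonic equation excludes any further component.\<close>

lemma G'_eq:
  assumes u: "u \<in> U"
  shows "G' u = (p u / \<sigma> u) *\<^sub>R N u - \<psi> u *\<^sub>R x u + (\<psi> u * \<nu> u) *\<^sub>R \<xi> u"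
proof -
  obtain k where k: "pderiv_at k f u \<noteq> 0"
    using sigma_pos[OF u] sigma_sum[OF u] by fastforce
  have xN: "N u \<bullet> x u = 0" by (rule grad_x[OF u])
  have xiN: "N u \<bullet> \<xi> u = 0"
    using xi_e[OF u] by (simp add: grad_def inner_sum_left inner_commute[of "e _ u"])
  have "pderiv_at k f u * (G' u \<bullet> x u) = pderiv_at k f u * (- \<psi> u)"
    using arg_cong[OF pderiv_G_expand[OF u, of k], of "\<lambda>w. w \<bullet> x u"] x_inner_e[OF u]
    by (simp add: inner_add_left pderiv_N[OF u] xN inner_commute[of "e k u"])
  then have Gx: "G' u \<bullet> x u = - \<psi> u" by (simp only: mult_left_cancel[OF k])
  have "pderiv_at k f u * (G' u \<bullet> \<xi> u) = pderiv_at k f u * (\<psi> u * \<nu> u)"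
    using arg_cong[OF pderiv_G_expand[OF u, of k], of "\<lambda>w. w \<bullet> \<xi> u"] xi_e[OF u]
    by (simp add: inner_add_left pderiv_N[OF u] xiN inner_commute[of "e k u"])
  then have Gxi: "G' u \<bullet> \<xi> u = \<psi> u * \<nu> u" by (simp only: mult_left_cancel[OF k])
  obtain \<theta> where \<theta>: "\<And>k. pderiv_at k \<psi> u = \<theta> * pderiv_at k f u" using pderiv_psi_f[OF u] by blast
  \<comment> \<open>The metric, the Hessian of \<open>f\<close> and the product of d\<psi> with df
    are all symmetric, the last because d\<psi> is a multiple of df. Hence the tangential part of
    \<open>G'\<close> is proportional to the gradient.\<close>
  have sym: "pderiv_at i f u * (G' u \<bullet> e j u) = pderiv_at j f u * (G' u \<bullet> e i u)" for i j
    using arg_cong[OF pderiv_G_expand[OF u, of i], of "\<lambda>w. w \<bullet> e j u"]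
      arg_cong[OF pderiv_G_expand[OF u, of j], of "\<lambda>w. w \<bullet> e i u"] pderiv_N(3)[OF u, of i j]
    by (simp add: inner_add_left \<theta> grad_inner_e[OF u] inner_commute[of "e j u" "e i u"])
  have Ge: "\<sigma> u * (G' u \<bullet> e j u) = pderiv_at j f u * p u" for j
  proof -
    have "\<sigma> u * (G' u \<bullet> e j u) = (\<Sum>i\<in>UNIV. gradient_coord x f u i * (pderiv_at i f u * (G' u \<bullet> e j u)))"
      by (simp add: sigma_sum[OF u, symmetric] sum_distrib_right mult.assoc)
    also have "\<dots> = pderiv_at j f u * p u"
      unfolding sym[of _ j] p_def by (subst grad_def) (simp add: inner_sum_right sum_distrib_left mult.left_commute)
    finally show ?thesis .
  qed
  define b where "b = G' u - (p u / \<sigma> u) *\<^sub>R N u + \<psi> u *\<^sub>R x u - (\<psi> u * \<nu> u) *\<^sub>R \<xi> u"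
  have bx: "b \<bullet> x u = 0"
    by (simp add: b_def inner_simps Gx xN xi_x[OF u] on_sphere[OF u])
  have bxi: "b \<bullet> \<xi> u = 0"
    using xi_x[OF u] by (simp add: b_def inner_simps Gxi xiN xi_xi[OF u] inner_commute[of "x u"])
  have be: "b \<bullet> e j u = 0" for j
    using Ge[of j] sigma_pos[OF u]
    by (simp add: b_def inner_simps grad_inner_e[OF u] xi_e[OF u] x_inner_e[OF u] field_simps)
  have bN: "b \<bullet> N u = 0" using be by (simp add: grad_def inner_sum_right)
  have "G' u \<bullet> b = b \<bullet> b"
    using bx bxi bN by (subst (2) b_def) (simp add: inner_simps inner_commute[of _ b])
  moreover have "G u \<bullet> b = 0" using bx bN by (simp add: G_def inner_simps inner_commute[of _ b])
  \<comment> \<open>In \<open>laplace_F\<close> paired with \<open>b\<close>, only the Laplacian of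
    \<xi> could balance this term, and \<open>laplace_xi_normal\<close> makes it vanish.\<close>
  ultimately have "\<sigma> u * (b \<bullet> b) = (\<Delta> f u *\<^sub>R G u + \<sigma> u *\<^sub>R G' u) \<bullet> b" by (simp add: inner_simps)
  also have "\<dots> = 0"
    unfolding laplace_F[OF u, symmetric] using laplace_xi_normal[OF u bx bxi be] bx bxi bN
    by (simp add: inner_simps inner_commute[of _ b])
  finally have "b = 0" using sigma_pos[OF u] by simp
  then show ?thesis by (simp add: b_def algebra_simps)
qed

text \<open>By \<open>G'_eq\<close> the second fundamental form of the gradient with any tangent
  vector lies along \<xi>, so 1 + \<nu> \<mu> is the sectional curvature of a plane containing the
  gradient. The identity results from differentiating \<open>G\<close> and \<open>G'\<close> along a
  vector tangent to a level set of \<open>f\<close>, where both derivatives vanish.\<close>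

lemma gauss_equation:
  assumes u: "u \<in> U"
  shows "p u * c * \<sigma> u + d\<^sup>2 * (f u)\<^sup>2 * (1 + \<nu> u * \<mu> u) = 0"
proof -
  obtain k where k: "pderiv_at k f u \<noteq> 0"
    using sigma_pos[OF u] sigma_sum[OF u] by fastforce
  have "CARD('m) \<noteq> 1" using m_gt_1[OF u] by (simp add: m_def)
  have "\<exists>l. l \<noteq> k"
  proof (rule ccontr)
    assume "\<nexists>l. l \<noteq> k"
    then have "(UNIV :: 'm set) = {k}" by auto
    then have "CARD('m) = card {k}" by (rule arg_cong)
    with \<open>CARD('m) \<noteq> 1\<close> show False by simp
  qed
  then obtain l where l: "l \<noteq> k" by blast
  \<comment> \<open>Coefficients of a vector annihilated by df. It is nonzero because
    \<open>f\<close> varies in direction \<open>k\<close> and there is a second coordinate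
    \<open>l\<close>.\<close>
  define Y where "Y i = (if i = k then - pderiv_at l f u else if i = l then pderiv_at k f u else 0)" for i
  have Ysum: "(\<Sum>i\<in>UNIV. Y i *\<^sub>R w i) = pderiv_at k f u *\<^sub>R w l - pderiv_at l f u *\<^sub>R w k" for w :: "'m \<Rightarrow> 'a"
  proof -
    have "(\<Sum>i\<in>UNIV. Y i *\<^sub>R w i) = (\<Sum>i\<in>{k, l}. Y i *\<^sub>R w i)"
      by (rule sum.mono_neutral_right) (auto simp: Y_def)
    then show ?thesis using l by (simp add: Y_def)
  qed
  have Yf: "(\<Sum>i\<in>UNIV. Y i * pderiv_at i f u) = 0"
  proof -
    have "(\<Sum>i\<in>UNIV. Y i * pderiv_at i f u) = (\<Sum>i\<in>{k, l}. Y i * pderiv_at i f u)"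
      by (rule sum.mono_neutral_right) (auto simp: Y_def)
    then show ?thesis using l by (simp add: Y_def)
  qed
  define y where "y = (\<Sum>i\<in>UNIV. Y i *\<^sub>R e i u)"
  have "y \<noteq> 0"
  proof
    assume "y = 0"
    then have "Y l = 0" unfolding y_def by (rule independent[OF u])
    then show False using k l by (simp add: Y_def)
  qed
  have Ny: "N u \<bullet> y = 0" using Yf by (simp add: y_def inner_sum_right grad_inner_e[OF u])
  have xy: "x u \<bullet> y = 0" by (simp add: y_def inner_sum_right x_inner_e[OF u])
  have xiy: "\<xi> u \<bullet> y = 0" by (simp add: y_def inner_sum_right xi_e[OF u])
  have yy: "(\<Sum>i\<in>UNIV. Y i * (e i u \<bullet> y)) = y \<bullet> y" by (subst (2) y_def) (simp add: inner_sum_left)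
  obtain \<theta> where \<theta>: "\<And>k. pderiv_at k \<psi> u = \<theta> * pderiv_at k f u" using pderiv_psi_f[OF u] by blast
  have N1: "\<psi> u * (pderiv_at i N u \<bullet> y) = pderiv_at i f u * (G' u \<bullet> y) - c * (e i u \<bullet> y)" for i
    using arg_cong[OF pderiv_G_expand[OF u, of i], of "\<lambda>w. w \<bullet> y"] by (simp add: inner_add_left Ny)
  \<comment> \<open>The derivative of \<open>G\<close> along \<open>y\<close> vanishes, which
    determines the second fundamental form of the level set of \<open>f\<close> on
    \<open>y\<close>.\<close>
  have N2: "\<psi> u * (\<Sum>i\<in>UNIV. Y i * (pderiv_at i N u \<bullet> y)) = - c * (y \<bullet> y)"
  proof -
    have "\<psi> u * (\<Sum>i\<in>UNIV. Y i * (pderiv_at i N u \<bullet> y)) = (\<Sum>i\<in>UNIV. Y i * (\<psi> u * (pderiv_at i N u \<bullet> y)))"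
      by (simp add: sum_distrib_left mult.left_commute)
    also have "\<dots> = (\<Sum>i\<in>UNIV. Y i * pderiv_at i f u) * (G' u \<bullet> y) - c * (\<Sum>i\<in>UNIV. Y i * (e i u \<bullet> y))"
      unfolding N1 by (simp add: right_diff_distrib sum_subtractf sum_distrib_left sum_distrib_right mult.assoc mult.left_commute)
    finally show ?thesis by (simp add: Yf yy)
  qed
  have xi2: "(\<Sum>i\<in>UNIV. Y i * (pderiv_at i \<xi> u \<bullet> y)) = - \<mu> u * (y \<bullet> y)"
  proof -
    have "pderiv_at i \<xi> u \<bullet> y = - \<mu> u * (e i u \<bullet> y)" for i
      by (simp add: pderiv_xi[OF u] inner_simps Ny)
    then show ?thesis by (simp add: yy[symmetric] sum_distrib_left mult.left_commute sum_negf)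
  qed
  have sm: "smooth_on U p" "smooth_on U (\<lambda>v. p v / \<sigma> v)"
  proof -
    show "smooth_on U p" unfolding p_def[abs_def] by (intro smooth_intros smooth_deriv_f smooth_G smooth_N)
    then show "smooth_on U (\<lambda>v. p v / \<sigma> v)"
      using sigma_pos by (intro smooth_on_divide[OF open_U] smooth_sigma) (auto simp: less_imp_neq[symmetric])
  qed
  have dG': "pderiv_at i G' u \<bullet> y = p u / \<sigma> u * (pderiv_at i N u \<bullet> y) - \<psi> u * (e i u \<bullet> y) + \<psi> u * \<nu> u * (pderiv_at i \<xi> u \<bullet> y)" for i
  proof -
    have "pderiv_at i G' u = pderiv_at i (\<lambda>v. (p v / \<sigma> v) *\<^sub>R N v - \<psi> v *\<^sub>R x v + (\<psi> v * \<nu> v) *\<^sub>R \<xi> v) u"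
      by (rule pderiv_at_cong[OF open_U u G'_eq diff_at[OF smooth_deriv_f[OF smooth_G] u]])
    then show ?thesis
      by (simp add: pderiv_at_add pderiv_at_diff pderiv_at_scaleR diff_at[OF _ u] smooth_intros sm smooth_N smooth_psi smooth_lambda smooth_xi
        inner_simps Ny xy xiy)
  qed
  \<comment> \<open>\<open>G'\<close> is again locally a function of \<open>f\<close>, so its
    derivative along \<open>y\<close> vanishes too; \<open>dG'\<close> expands it through
    \<open>G'_eq\<close>.\<close>
  have "0 = (\<Sum>i\<in>UNIV. Y i * (pderiv_at i G' u \<bullet> y))"
    using Yf by (simp add: pderiv_G'[OF u] mult.assoc[symmetric] flip: sum_distrib_right)
  also have "\<dots> = p u / \<sigma> u * (\<Sum>i\<in>UNIV. Y i * (pderiv_at i N u \<bullet> y)) - \<psi> u * (\<Sum>i\<in>UNIV. Y i * (e i u \<bullet> y))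
      + \<psi> u * \<nu> u * (\<Sum>i\<in>UNIV. Y i * (pderiv_at i \<xi> u \<bullet> y))"
    unfolding dG' by (simp add: distrib_left right_diff_distrib sum.distrib sum_subtractf sum_distrib_left mult.left_commute)
  finally have "0 = \<psi> u * (p u / \<sigma> u * (\<Sum>i\<in>UNIV. Y i * (pderiv_at i N u \<bullet> y)) - \<psi> u * (y \<bullet> y) - \<psi> u * \<nu> u * \<mu> u * (y \<bullet> y))"
    unfolding yy xi2 by simp
  also have "\<dots> = - (p u * c / \<sigma> u + (\<psi> u)\<^sup>2 * (1 + \<nu> u * \<mu> u)) * (y \<bullet> y)"
    using arg_cong[OF N2, of "\<lambda>t. p u / \<sigma> u * t"] by (simp add: algebra_simps power2_eq_square)
  finally have "p u * c / \<sigma> u + (\<psi> u)\<^sup>2 * (1 + \<nu> u * \<mu> u) = 0" using \<open>y \<noteq> 0\<close> by simp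
  then have "(p u * c / \<sigma> u + (\<psi> u)\<^sup>2 * (1 + \<nu> u * \<mu> u)) * (\<sigma> u)\<^sup>2 = 0" by simp
  moreover have "(p u * c / \<sigma> u + (\<psi> u)\<^sup>2 * (1 + \<nu> u * \<mu> u)) * (\<sigma> u)\<^sup>2 = p u * c * \<sigma> u + (\<psi> u * \<sigma> u)\<^sup>2 * (1 + \<nu> u * \<mu> u)"
    using sigma_pos[OF u] by (simp add: field_simps power2_eq_square)
  ultimately show ?thesis by (simp add: psi_sigma[OF u] power_mult_distrib)
qed

section \<open>Scalar equations for \<open>f\<close>, its Laplacian, \<sigma> and
  \<open>p\<close>\<close>

lemma gauss_equation_f:
  assumes u: "u \<in> U"
  shows "p u * c * \<sigma> u + d\<^sup>2 * (f u)\<^sup>2 * (1 - m / 2 * c * (f u)\<^sup>2) = 0"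
proof -
  have "1 + \<nu> u * \<mu> u = 1 - m / 2 * c * (f u)\<^sup>2"
    by (simp add: \<nu>_def mu_c[OF u] power2_eq_square)
  then show ?thesis using gauss_equation[OF u] by (simp only:)
qed

text \<open>The \<xi> component of \<open>laplace_F\<close> evaluates the product of \<xi> with its
  Laplacian, which is then put into \<open>laplace_f\<close>.\<close>

lemma laplace_f_eq:
  assumes u: "u \<in> U"
  shows "\<Delta> f u = - m * f u + (d * m / 2 + c * m) * f u ^ 3"
proof -
  have xiN: "N u \<bullet> \<xi> u = 0"
    using xi_e[OF u] by (simp add: grad_def inner_sum_left inner_commute[of "e _ u"])
  note xi = xi_x[OF u] xi_xi[OF u] xiN inner_commute[of "x u" "\<xi> u"]
  have "(\<Delta> f u *\<^sub>R G u + \<sigma> u *\<^sub>R G' u) \<bullet> \<xi> u = d * f u * \<nu> u"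
    unfolding G'_eq[OF u] using psi_sigma[OF u] by (simp add: G_def inner_simps xi mult.commute mult.left_commute)
  then have xixi: "\<Delta> \<xi> u \<bullet> \<xi> u = d * f u * \<nu> u - c * m * (f u)\<^sup>2"
    unfolding laplace_F[OF u, symmetric] by (simp add: inner_simps xi power2_eq_square algebra_simps)
  show ?thesis using laplace_f[OF u] unfolding xixi
    by (simp add: \<nu>_def power2_eq_square power3_eq_cube algebra_simps)
qed

text \<open>The component of \<open>laplace_F\<close> along the gradient, with the traced Codazzi
  identity for the Laplacian of \<xi>.\<close>

lemma laplace_f_sigma:
  assumes u: "u \<in> U"
  shows "d * f u * \<Delta> f u + \<sigma> u * p u = (2 * c - m) * \<sigma> u"
proof -
  have xiN: "\<xi> u \<bullet> N u = 0"
    using xi_e[OF u] by (simp add: grad_def inner_sum_right)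
  have xN: "x u \<bullet> N u = 0" using grad_x[OF u, of f] by (simp add: inner_commute)
  have "\<Delta> \<xi> u \<bullet> N u = - m * \<sigma> u"
    by (subst grad_def) (simp add: inner_sum_right laplace_xi_e[OF u] sigma_sum[OF u, symmetric] sum_distrib_left mult.left_commute sum_negf)
  then show ?thesis
    using arg_cong[OF laplace_F[OF u], of "\<lambda>w. w \<bullet> N u"] psi_sigma[OF u]
    by (simp add: G_def inner_simps xiN xN \<sigma>_def[symmetric] p_def[symmetric] algebra_simps)
qed

text \<open>Eliminates \<open>p\<close> and the Laplacian of \<open>f\<close>. It holds on all of
  \<open>U\<close> and so can be differentiated; products instead of powers suit the product
  rule.\<close>

lemma first_order_equation:
  assumes u: "u \<in> U"
  shows "c * (2 * c - m) * \<sigma> u = - d * (c * m + d) * (f u * f u) + c * d * m * (c + d) * (f u * f u * (f u * f u))"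
proof -
  have "c * (2 * c - m) * \<sigma> u = c * d * f u * \<Delta> f u + p u * c * \<sigma> u"
    using arg_cong[OF laplace_f_sigma[OF u], of "\<lambda>t. c * t"] by (simp add: algebra_simps)
  also have "\<dots> = c * d * f u * \<Delta> f u - d\<^sup>2 * (f u)\<^sup>2 * (1 - m / 2 * c * (f u)\<^sup>2)"
    using gauss_equation_f[OF u] by simp
  also have "\<dots> = - d * (c * m + d) * (f u * f u) + c * d * m * (c + d) * (f u * f u * (f u * f u))"
    unfolding laplace_f_eq[OF u] by (simp add: power2_eq_square power3_eq_cube algebra_simps)
  finally show ?thesis .
qed

lemma noncmc_locus_empty: "U = {}"
proof (rule ccontr)
  assume "U \<noteq> {}"
  then obtain u where u: "u \<in> U" by blast
  obtain k where k: "pderiv_at k f u \<noteq> 0"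
    using sigma_pos[OF u] sigma_sum[OF u] by fastforce
  \<comment> \<open>The derivative of \<sigma> with respect to \<open>f\<close>.\<close>
  define r where "r = 2 * (c + d - p u) / \<psi> u"
  have r: "pderiv_at k \<sigma> u = r * pderiv_at k f u"
    using pderiv_sigma[OF u, of k] psi_pos[OF u] by (simp add: r_def field_simps)
  have "pderiv_at k (\<lambda>v. c * (2 * c - m) * \<sigma> v) u = pderiv_at k (\<lambda>v. - d * (c * m + d) * (f v * f v) + c * d * m * (c + d) * (f v * f v * (f v * f v))) u"
    by (rule pderiv_at_cong[OF open_U u first_order_equation]) (assumption, intro diff_at[OF _ u] smooth_intros smooth_sigma)
  moreover have "pderiv_at k (\<lambda>v. c * (2 * c - m) * \<sigma> v) u = c * (2 * c - m) * r * pderiv_at k f u"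
    by (simp add: pderiv_at_mult diff_at[OF _ u] smooth_intros smooth_sigma r)
  moreover have "pderiv_at k (\<lambda>v. - d * (c * m + d) * (f v * f v) + c * d * m * (c + d) * (f v * f v * (f v * f v))) u
      = - d * (c * m + d) * (pderiv_at k f u * f u + f u * pderiv_at k f u) + c * d * m * (c + d) *
        ((pderiv_at k f u * f u + f u * pderiv_at k f u) * (f u * f u) + f u * f u * (pderiv_at k f u * f u + f u * pderiv_at k f u))"
    by (simp add: pderiv_at_mult pderiv_at_diff diff_at[OF _ u] smooth_intros smooth_f)
  ultimately have "c * (2 * c - m) * r * pderiv_at k f u = (- 2 * d * (c * m + d) * f u + 4 * c * d * m * (c + d) * f u ^ 3) * pderiv_at k f u"
    by (simp add: power3_eq_cube algebra_simps)
  then have deriv: "c * (2 * c - m) * r = - 2 * d * (c * m + d) * f u + 4 * c * d * m * (c + d) * f u ^ 3"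
    using k by simp
  have "r * \<psi> u = 2 * (c + d - p u)" using psi_pos[OF u] by (simp add: r_def)
  then have "r * (\<psi> u * \<sigma> u) = 2 * \<sigma> u * (c + d - p u)" by (simp add: mult.assoc[symmetric])
  then have rel: "r * d * f u = 2 * \<sigma> u * (c + d - p u)" by (simp add: psi_sigma[OF u] mult.assoc)
  show False
    by (rule no_solution[OF m_gt_1[OF u] mean_curvature_pos[OF u] c_def d_def rel gauss_equation_f[OF u] laplace_f_eq[OF u] laplace_f_sigma[OF u] deriv])
qed

end

theorem theorem4p3:
  fixes M :: "'a::euclidean_space topology"
  assumes "submanifold_of_sphere TYPE('m::finite) M"
    and "PNMC TYPE('m) M"
    and "biharmonic TYPE('m) M"
    and "at_most_two_principal_curvatures_along_H TYPE('m) M"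
  shows "PMC TYPE('m) M"
  unfolding PMC_def
proof (intro allI impI ballI)
  fix U and x :: "real^'m \<Rightarrow> 'a" and u h
  assume lp: "local_parametrization M U x" and u: "u \<in> U"
  let ?f = "mean_curvature x"
  have "x v \<in> sphere 0 1" if "v \<in> U" for v
    using lp that assms(1) openin_subset unfolding local_parametrization_def submanifold_of_sphere_def by blast
  then have sphere: "x v \<bullet> x v = 1" if "v \<in> U" for v
    using that by (simp add: dot_square_norm)
  interpret pnmc_biharmonic_patch U x "real CARD('m)"
    using lp sphere assms(2,3)
    by unfold_locales (auto simp: local_parametrization_def PNMC_def biharmonic_def)
  \<comment> \<open>The contradiction was derived for patches where the gradient has no zero; all
    its hypotheses restrict to this open subset.\<close>
  define V where "V = {v \<in> U. grad ?f v \<noteq> 0}"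
  have "open V"
  proof -
    have "continuous_on U (grad ?f)" by (intro smooth_on_continuous smooth_grad smooth_f)
    then have "open (U \<inter> grad ?f -` (- {0}))" by (rule continuous_open_preimage[OF _ open_U]) auto
    moreover have "U \<inter> grad ?f -` (- {0}) = V" by (auto simp: V_def)
    ultimately show ?thesis by simp
  qed
  have VU: "V \<subseteq> U" by (auto simp: V_def)
  interpret V: noncmc_patch V x "real CARD('m)"
  proof unfold_locales
    show "finite (weingarten_eigenvalues x H v) \<and> card (weingarten_eigenvalues x H v) \<le> 2" if "v \<in> V" for v
      using lp assms(4) that VU unfolding at_most_two_principal_curvatures_along_H_def by blast
    show "grad ?f v \<noteq> 0" if "v \<in> V" for v using that by (simp add: V_def)
  qed (use VU \<open>open V\<close> smooth_on_subset[OF smooth_x VU] inj_dx sphere mean_curvature_pos parallel biharm in auto)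
  \<comment> \<open>With \<open>V\<close> empty, \<open>f\<close> is stationary at \<open>u\<close>,
    and \<open>H\<close> is \<open>f\<close> times the parallel field \<xi>.\<close>
  have "grad ?f u = 0" using V.noncmc_locus_empty u by (auto simp: V_def)
  then have "pderiv_at i ?f u = 0" for i using grad_inner_e[OF u, of ?f i] by simp
  then show "normal_connection x h (mean_curvature_vector x) u = 0" by (rule normal_connection_H[OF u])
qed

end
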